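(* Let $n\ge 3$, let $G=\mathrm{SL}_n(\mathbb{Z})$, and let $H\le G$ be a subgroup. Then the following are equivalent: 1. $(G,H)\in\mathbf{SLC}_{\mathrm{subexp}}$; 2. $(G,H)$ has pair rapid decay; 3. $H$ has finite index in $G$.
   Context: Let $\ell$ be the word length on $G$ for a finite symmetric generating set. For $f\in\mathbb{C}G$, $\|f\|_{(2,1)}:=\bigl(\sum_{x\in G/H}(\sum_{g\in x}|f(g)|)^2\bigr)^{1/2}$ (sum over left cosets) and $\|f\|_h:=\sup\{\|f*\varphi\|_{(2,1)}:\varphi\in\mathbb{C}G,\ \|\varphi\|_{(2,1)}=1\}$. Pair rapid decay: there exist $C_h,s_1>0$ such that $\|f\|_h\le C_h\|f(1+\ell)^{s_1}\|_{(2,1)}$ for all $f\in\mathbb{C}G$. $(G,H)\in\mathbf{SLC}_{\mathrm{subexp}}$: there exist $C_h>0$ and $w:G\to[1,\infty)$ such that $\|f\|_h\le C_h\|fw\|_{(2,1)}$ for all $f\in\mathbb{C}G$ and $W(t):=\sup\{w(g):\ell(g)\le t\}$ satisfies $\lim_{t\to\infty}\frac{\log W(t)}{t}=0$. *)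

theory Defs
  imports
    Complex_Main
    "HOL-Algebra.Left_Coset"
    "HOL-Algebra.Generated_Groups"
    "HOL-Analysis.Infinite_Sum"
    "Jordan_Normal_Form.Determinant"
begin

definition SL_int :: "nat \<Rightarrow> int mat monoid" where
  "SL_int n = \<lparr>carrier = {A \<in> carrier_mat n n. det A = 1}, monoid.mult = (*), one = 1\<^sub>m n\<rparr>"

lemma group_SL_int: "group (SL_int n)"
proof (rule groupI)
  fix A assume "A \<in> carrier (SL_int n)"
  then have A: "A \<in> carrier_mat n n" "det A = 1" by (auto simp: SL_int_def)
  have "adj_mat A * A = 1\<^sub>m n" using adj_mat(3)[OF A(1)] A(2) by (auto intro: eq_matI)
  moreover from this have "det (adj_mat A) = 1"
    using det_mult[OF adj_mat(1)[OF A(1)] A(1)] A(2) by simp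
  ultimately show "\<exists>B\<in>carrier (SL_int n). B \<otimes>\<^bsub>SL_int n\<^esub> A = \<one>\<^bsub>SL_int n\<^esub>"
    using adj_mat(1)[OF A(1)] by (auto simp: SL_int_def)
qed (auto simp: SL_int_def det_mult)

definition symmetric_generating_set :: "('a, 'b) monoid_scheme \<Rightarrow> 'a set \<Rightarrow> bool" where
  "symmetric_generating_set G S \<longleftrightarrow>
     S \<subseteq> carrier G \<and> (\<forall>s\<in>S. inv\<^bsub>G\<^esub> s \<in> S) \<and> generate G S = carrier G"

definition word_length :: "('a, 'b) monoid_scheme \<Rightarrow> 'a set \<Rightarrow> 'a \<Rightarrow> nat" where
  "word_length G S g =
     (LEAST k. \<exists>xs. length xs = k \<and> set xs \<subseteq> S \<and> foldr (\<otimes>\<^bsub>G\<^esub>) xs \<one>\<^bsub>G\<^esub> = g)"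

text \<open>An element of the complex group algebra is a function on the whole type that vanishes
  off a finite subset of the carrier. All infinite sums below are applied to such functions,
  so they have only finitely many nonzero terms.\<close>

definition group_algebra :: "('a, 'b) monoid_scheme \<Rightarrow> ('a \<Rightarrow> complex) set" where
  "group_algebra G = {f. finite {g. f g \<noteq> 0} \<and> {g. f g \<noteq> 0} \<subseteq> carrier G}"

definition convolution ::
    "('a, 'b) monoid_scheme \<Rightarrow> ('a \<Rightarrow> complex) \<Rightarrow> ('a \<Rightarrow> complex) \<Rightarrow> 'a \<Rightarrow> complex" where
  "convolution G f \<phi> g =
     (if g \<in> carrier G
      then (\<Sum>\<^sub>\<infinity>h\<in>carrier G. f h * \<phi> (inv\<^bsub>G\<^esub> h \<otimes>\<^bsub>G\<^esub> g)) else 0)"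

definition norm21 :: "('a, 'b) monoid_scheme \<Rightarrow> 'a set \<Rightarrow> ('a \<Rightarrow> complex) \<Rightarrow> real" where
  "norm21 G H f =
     sqrt (\<Sum>\<^sub>\<infinity>x\<in>lcosets\<^bsub>G\<^esub> H. (\<Sum>\<^sub>\<infinity>g\<in>x. cmod (f g))\<^sup>2)"

text \<open>For a subgroup \<open>H\<close> and \<open>f\<close> in the group algebra the set below is nonempty (take the
  indicator of the identity) and bounded above by the \<open>l\<^sup>1\<close>-norm of \<open>f\<close>, because left
  translations preserve the \<open>(2,1)\<close>-norm. Hence the real supremum is the intended one.\<close>

definition norm_h :: "('a, 'b) monoid_scheme \<Rightarrow> 'a set \<Rightarrow> ('a \<Rightarrow> complex) \<Rightarrow> real" where
  "norm_h G H f =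
     Sup {norm21 G H (convolution G f \<phi>) | \<phi>. \<phi> \<in> group_algebra G \<and> norm21 G H \<phi> = 1}"

definition pair_rapid_decay ::
    "('a, 'b) monoid_scheme \<Rightarrow> 'a set \<Rightarrow> ('a \<Rightarrow> nat) \<Rightarrow> bool" where
  "pair_rapid_decay G H len \<longleftrightarrow>
     (\<exists>C s :: real. C > 0 \<and> s > 0 \<and>
       (\<forall>f\<in>group_algebra G.
          norm_h G H f \<le> C * norm21 G H (\<lambda>g. f g * of_real ((1 + real (len g)) powr s))))"

text \<open>When \<open>len\<close> is the word length of a finite generating set, its balls are finite, so the
  supremum is attained for every \<open>t \<ge> 0\<close>.\<close>

definition weight_growth ::
    "('a, 'b) monoid_scheme \<Rightarrow> ('a \<Rightarrow> nat) \<Rightarrow> ('a \<Rightarrow> real) \<Rightarrow> real \<Rightarrow> real" where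
  "weight_growth G len w t = Sup {w g | g. g \<in> carrier G \<and> real (len g) \<le> t}"

definition SLC_subexp ::
    "('a, 'b) monoid_scheme \<Rightarrow> 'a set \<Rightarrow> ('a \<Rightarrow> nat) \<Rightarrow> bool" where
  "SLC_subexp G H len \<longleftrightarrow>
     (\<exists>(C :: real) (w :: 'a \<Rightarrow> real). C > 0 \<and> (\<forall>g\<in>carrier G. w g \<ge> 1) \<and>
       (\<forall>f\<in>group_algebra G.
          norm_h G H f \<le> C * norm21 G H (\<lambda>g. f g * of_real (w g))) \<and>
       ((\<lambda>t. ln (weight_growth G len w t) / t) \<longlongrightarrow> 0) at_top)"

definition finite_index :: "('a, 'b) monoid_scheme \<Rightarrow> 'a set \<Rightarrow> bool" where
  "finite_index G H \<longleftrightarrow> finite (lcosets\<^bsub>G\<^esub> H)"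

end

theory Submission
  imports Defs "HOL-Analysis.L2_Norm" "HOL-Real_Asymp.Real_Asymp"
begin

text \<open>A finite index subgroup has pair rapid decay because \<open>norm_h\<close> is at most the \<open>l\<^sup>1\<close>-norm, which
  finite index bounds by the \<open>(2,1)\<close>-norm. Conversely, powers of elementary matrices are
  exponentially distorted when \<open>n \<ge> 3\<close>, so a subexponential weight forces a power of each of them
  into \<open>H\<close>. Hence \<open>H\<close> contains, for some modulus \<open>q\<close>, all transvections \<open>I + q v w\<^sup>T\<close> with \<open>v\<close>
  unimodular and \<open>w\<close> orthogonal to \<open>v\<close>, and the normal subgroup \<open>N\<close> that they generate. This \<open>N\<close>
  acts transitively on the unimodular vectors in each class modulo \<open>q\<close>; so, modulo \<open>N\<close>, the
  transvections \<open>I + v w\<^sup>T\<close> form a finite conjugation invariant set of elements of exponent \<open>q\<close>.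
  They generate the whole group by the Euclidean algorithm, and Dietzmann's lemma shows that \<open>N\<close>
  has finite index.\<close>

section \<open>Groups generated by finitely many torsion conjugates\<close>

text \<open>The test function behind the distortion step is the indicator of the first 2^L powers of
  an elementary matrix. Its \<open>norm_h\<close> is of order 2^L, its (2,1)-norm is only 2^(L/2),
  and its support lies in a ball of radius linear in L, so the weight is forced to be exponential
  there. The algebraic obstacle is that \<open>H\<close> need not be normal: elementary matrices in
  \<open>H\<close> say nothing directly about their conjugates. To find inside \<open>H\<close> a
  subgroup that is normal in G, transvections in every unimodular direction have to be assembled
  from coordinate ones of some level m. The assembly uses a commutator, which multiplies two levels,
  and this is why q is the square of m. The q-torsion modulo \<open>N\<close> comes from (I + v
  w^T)^q = I + q v w^T, valid because w is orthogonal to v. The third coordinate enters three times: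
  as the pivot of that commutator, as room for a hyperbolic 2 x 2 block to act on a plane of
  transvections, and in making entries coprime when a vector is moved within its class modulo
  q.\<close>

lemma (in group) foldr_mult_closed [simp]:
  "set xs \<subseteq> carrier G \<Longrightarrow> foldr (\<otimes>) xs \<one> \<in> carrier G"
  by (induction xs) auto

lemma (in group) foldr_mult_append:
  assumes "set xs \<subseteq> carrier G" "set ys \<subseteq> carrier G"
  shows "foldr (\<otimes>) (xs @ ys) \<one> = foldr (\<otimes>) xs \<one> \<otimes> foldr (\<otimes>) ys \<one>"
  using assms by (induction xs) (auto simp: m_assoc)

lemma (in group) foldr_mult_conj:
  assumes "set xs \<subseteq> carrier G" "x \<in> carrier G"
  shows "x \<otimes> foldr (\<otimes>) (map (\<lambda>a. inv x \<otimes> a \<otimes> x) xs) \<one> = foldr (\<otimes>) xs \<one> \<otimes> x"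
  using assms
proof (induction xs)
  case (Cons a xs)
  let ?r = "foldr (\<otimes>) (map (\<lambda>a. inv x \<otimes> a \<otimes> x) xs) \<one>"
  have r: "?r \<in> carrier G"
    by (rule foldr_mult_closed) (use Cons.prems in auto)
  have "x \<otimes> ((inv x \<otimes> a \<otimes> x) \<otimes> ?r) = a \<otimes> (x \<otimes> ?r)"
    using Cons.prems r by (simp add: m_assoc[symmetric])
  also have "\<dots> = a \<otimes> (foldr (\<otimes>) xs \<one> \<otimes> x)"
    using Cons by simp
  finally show ?case
    using Cons.prems by (simp add: m_assoc)
qed auto

text \<open>Moving \<open>x\<close> leftwards across letters conjugates them by \<open>x\<close>.
  Each round pulls the first occurrence, so the letters passed over differ from \<open>x\<close>,
  and so do their conjugates; exactly one occurrence is used up and the remaining rounds stay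
  possible.\<close>

lemma (in group) foldr_mult_pull_front:
  assumes X: "X \<subseteq> carrier G" "\<And>x y. x \<in> X \<Longrightarrow> y \<in> X \<Longrightarrow> inv x \<otimes> y \<otimes> x \<in> X"
    and "set xs \<subseteq> X" "x \<in> X" "k \<le> count_list xs x"
  shows "\<exists>ys. set ys \<subseteq> X \<and> length ys + k = length xs \<and> count_list ys x + k = count_list xs x \<and>
    foldr (\<otimes>) xs \<one> = x [^] k \<otimes> foldr (\<otimes>) ys \<one>"
  using assms(5)
proof (induction k)
  case 0
  then show ?case using assms by (intro exI[of _ xs]) auto
next
  case (Suc k)
  then obtain ys where ys: "set ys \<subseteq> X" "length ys + k = length xs"
    "count_list ys x + k = count_list xs x"
    "foldr (\<otimes>) xs \<one> = x [^] k \<otimes> foldr (\<otimes>) ys \<one>"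
    by auto
  have "count_list ys x \<noteq> 0"
    using Suc.prems ys(3) by linarith
  then have "x \<in> set ys"
    by (metis count_list_0_iff)
  then obtain as bs where split: "ys = as @ x # bs" "x \<notin> set as"
    by (meson split_list_first)
  define as' where "as' = map (\<lambda>a. inv x \<otimes> a \<otimes> x) as"
  have xc: "x \<in> carrier G" and asc: "set as \<subseteq> carrier G" and bsc: "set bs \<subseteq> carrier G"
    using X(1) assms(4) ys(1) split by auto
  have as'X: "set as' \<subseteq> X"
    using X(2) assms(4) ys(1) split by (auto simp: as'_def)
  have "x \<notin> set as'"
  proof
    assume "x \<in> set as'"
    then obtain a where a: "a \<in> set as" "x = inv x \<otimes> a \<otimes> x"
      by (auto simp: as'_def)
    then have "inv x \<otimes> a = \<one>"
      using xc asc by (metis inv_closed m_closed r_cancel_one subsetD)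
    then have "a = x"
      using a xc asc by (metis inv_closed inv_equality inv_inv inv_comm subsetD)
    then show False using a split by simp
  qed
  then have cnt: "count_list as' x = 0" "count_list as x = 0"
    using split(2) by (auto simp: count_list_0_iff)
  have "foldr (\<otimes>) ys \<one> = foldr (\<otimes>) as \<one> \<otimes> (x \<otimes> foldr (\<otimes>) bs \<one>)"
    using foldr_mult_append[of as "x # bs"] asc bsc xc split by simp
  also have "\<dots> = (foldr (\<otimes>) as \<one> \<otimes> x) \<otimes> foldr (\<otimes>) bs \<one>"
    using asc bsc xc by (simp add: m_assoc)
  also have "\<dots> = (x \<otimes> foldr (\<otimes>) as' \<one>) \<otimes> foldr (\<otimes>) bs \<one>"
    using foldr_mult_conj[OF asc xc] by (simp add: as'_def)
  also have "\<dots> = x \<otimes> foldr (\<otimes>) (as' @ bs) \<one>"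
    using foldr_mult_append[of as' bs] as'X X(1) bsc xc by (simp add: m_assoc)
  finally have "foldr (\<otimes>) xs \<one> = x [^] Suc k \<otimes> foldr (\<otimes>) (as' @ bs) \<one>"
    using ys(4) xc foldr_mult_closed[of "as' @ bs"] as'X X(1) bsc
    by (simp add: m_assoc del: foldr_append)
  moreover have "set (as' @ bs) \<subseteq> X"
    using as'X ys(1) split by auto
  moreover have "length (as' @ bs) + Suc k = length xs"
    using ys(2) split by (simp add: as'_def)
  moreover have "count_list (as' @ bs) x + Suc k = count_list xs x"
    using ys(3) split cnt by simp
  ultimately show ?case by blast
qed

lemma (in group) generate_eq_foldr:
  assumes "X \<subseteq> carrier G" "\<And>x. x \<in> X \<Longrightarrow> inv x \<in> X" "g \<in> generate G X"
  shows "\<exists>xs. set xs \<subseteq> X \<and> foldr (\<otimes>) xs \<one> = g"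
  using assms(3)
proof induction
  case one
  show ?case by (intro exI[of _ "[]"]) auto
next
  case (incl h)
  then show ?case using assms(1) by (intro exI[of _ "[h]"]) auto
next
  case (inv h)
  then show ?case using assms by (intro exI[of _ "[inv h]"]) auto
next
  case (eng h1 h2)
  then obtain xs ys where "set xs \<subseteq> X" "foldr (\<otimes>) xs \<one> = h1" "set ys \<subseteq> X" "foldr (\<otimes>) ys \<one> = h2"
    by auto
  then show ?case using assms(1) foldr_mult_append[of xs ys]
    by (intro exI[of _ "xs @ ys"]) auto
qed

text \<open>Dietzmann's lemma. In a word longer than \<open>card X * q\<close> some letter occurs \<open>q\<close> times;
  pulling these occurrences to the front only conjugates the other letters, and their product
  is the identity.\<close>

lemma (in group) finite_generate_if_conj_closed:
  assumes X: "X \<subseteq> carrier G" "finite X"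
    and conj: "\<And>x y. x \<in> X \<Longrightarrow> y \<in> X \<Longrightarrow> inv x \<otimes> y \<otimes> x \<in> X"
    and inverse: "\<And>x. x \<in> X \<Longrightarrow> inv x \<in> X"
    and exponent: "\<And>x. x \<in> X \<Longrightarrow> x [^] (q::nat) = \<one>" and q: "q > 0"
  shows "finite (generate G X)"
proof -
  have short: "\<exists>ys. set ys \<subseteq> X \<and> length ys \<le> card X * q \<and> foldr (\<otimes>) ys \<one> = foldr (\<otimes>) xs \<one>"
    if "set xs \<subseteq> X" for xs
    using that
  proof (induction "length xs" arbitrary: xs rule: less_induct)
    case less
    show ?case
    proof (cases "length xs \<le> card X * q")
      case False
      have "\<exists>x\<in>X. q \<le> count_list xs x"
      proof (rule ccontr)
        assume "\<not> ?thesis"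
        then have "(\<Sum>x\<in>X. count_list xs x) \<le> (\<Sum>x\<in>X. q)"
          by (intro sum_mono) auto
        then show False
          using False sum_count_set[OF less.prems X(2)] by simp
      qed
      then obtain x where x: "x \<in> X" "q \<le> count_list xs x" by auto
      obtain ys where ys: "set ys \<subseteq> X" "length ys + q = length xs"
        "foldr (\<otimes>) xs \<one> = x [^] q \<otimes> foldr (\<otimes>) ys \<one>"
        using foldr_mult_pull_front[OF X(1) conj less.prems x] by metis
      have "foldr (\<otimes>) xs \<one> = foldr (\<otimes>) ys \<one>"
        using ys exponent[OF x(1)] X(1) by simp
      then show ?thesis
        using less.hyps[of ys] ys q by auto
    qed (use less.prems in auto)
  qed
  have "generate G X \<subseteq> (\<lambda>ys. foldr (\<otimes>) ys \<one>) ` {ys. set ys \<subseteq> X \<and> length ys \<le> card X * q}"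
  proof
    fix g assume "g \<in> generate G X"
    then obtain xs where "set xs \<subseteq> X" "foldr (\<otimes>) xs \<one> = g"
      using generate_eq_foldr[OF X(1) inverse] by blast
    then obtain ys where "set ys \<subseteq> X" "length ys \<le> card X * q" "foldr (\<otimes>) ys \<one> = g"
      using short[of xs] by blast
    then show "g \<in> (\<lambda>ys. foldr (\<otimes>) ys \<one>) ` {ys. set ys \<subseteq> X \<and> length ys \<le> card X * q}"
      by blast
  qed
  then show ?thesis
    by (rule finite_subset) (intro finite_imageI finite_lists_length_le X)
qed

text \<open>As \<open>N\<close> lies in \<open>H\<close>, the coset \<open>a <# H\<close> is the
  product of the \<open>N\<close>-coset of \<open>a\<close> with \<open>H\<close>, so the cosets of
  \<open>H\<close> are an image of the quotient by \<open>N\<close>.\<close>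

lemma (in group) finite_lcosets_if_finite_FactGroup:
  assumes N: "N \<lhd> G" and H: "subgroup H G" and "N \<subseteq> H" and fin: "finite (carrier (G Mod N))"
  shows "finite (lcosets H)"
proof -
  interpret N: normal N G by fact
  have "lcosets H \<subseteq> (\<lambda>C. C <#> H) ` carrier (G Mod N)"
  proof
    fix x assume "x \<in> lcosets H"
    then obtain a where a: "a \<in> carrier G" "x = a <# H"
      by (auto simp: LCOSETS_def)
    have "N <#> H = H"
    proof
      show "N <#> H \<subseteq> H"
        using assms(3) subgroup.m_closed[OF H] by (auto simp: set_mult_def)
      show "H \<subseteq> N <#> H"
      proof
        fix h assume "h \<in> H"
        then show "h \<in> N <#> H"
          using subgroup.mem_carrier[OF H] N.one_closed
          unfolding set_mult_def by (intro UN_I[of \<one>] UN_I[of h]) auto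
      qed
    qed
    then have "(a <# N) <#> H = a <# H"
      using a set_mult_assoc[of "{a}" N H] N.subset subgroup.subset[OF H]
      by (simp add: l_coset_eq_set_mult)
    moreover have "a <# N = N #> a"
      using N.coset_eq a by simp
    ultimately show "x \<in> (\<lambda>C. C <#> H) ` carrier (G Mod N)"
      using a by (auto simp: FactGroup_def RCOSETS_def image_iff intro!: bexI[of _ a])
  qed
  then show ?thesis
    using fin finite_surj by blast
qed

section \<open>The norms of the group algebra\<close>

locale group_with_subgroup = group G for G (structure) +
  fixes H
  assumes subgroup_H: "subgroup H G"
begin

lemma lcoset_mem_iff:
  "a \<in> carrier G \<Longrightarrow> b \<in> carrier G \<Longrightarrow> b \<in> a <# H \<longleftrightarrow> inv a \<otimes> b \<in> H"
  using subgroup.lcos_module_imp[OF subgroup_H is_group] subgroup.lcos_module_rev[OF subgroup_H is_group]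
  by blast

lemma lcoset_eq_iff:
  assumes "a \<in> carrier G" "b \<in> carrier G"
  shows "a <# H = b <# H \<longleftrightarrow> inv a \<otimes> b \<in> H"
  using assms lcoset_mem_iff lcos_self[OF _ subgroup_H] l_repr_independence[OF _ _ subgroup_H]
  by metis

lemma mem_lcoset_iff_eq:
  "a \<in> carrier G \<Longrightarrow> b \<in> carrier G \<Longrightarrow> b \<in> a <# H \<longleftrightarrow> b <# H = a <# H"
  using lcoset_mem_iff lcoset_eq_iff by metis

text \<open>Turns both infinite sums into finite ones. \<open>F\<close> may exceed the support, so
  that several functions can be compared over one common index set.\<close>

lemma norm21_finite:
  assumes "finite F" "F \<subseteq> carrier G" "{g. f g \<noteq> 0} \<subseteq> F"
  shows "norm21 G H f = L2_set (\<lambda>x. \<Sum>g\<in>F \<inter> x. cmod (f g)) ((\<lambda>g. g <# H) ` F)"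
proof -
  have inner: "(\<Sum>\<^sub>\<infinity>g\<in>x. cmod (f g)) = (\<Sum>g\<in>F \<inter> x. cmod (f g))" for x
  proof -
    have "(\<Sum>\<^sub>\<infinity>g\<in>x. cmod (f g)) = (\<Sum>\<^sub>\<infinity>g\<in>F \<inter> x. cmod (f g))"
      using assms(3) by (intro infsum_cong_neutral) auto
    then show ?thesis using assms(1) by simp
  qed
  have "(\<Sum>\<^sub>\<infinity>x\<in>lcosets H. (\<Sum>g\<in>F \<inter> x. cmod (f g))\<^sup>2) =
      (\<Sum>\<^sub>\<infinity>x\<in>(\<lambda>g. g <# H) ` F. (\<Sum>g\<in>F \<inter> x. cmod (f g))\<^sup>2)"
  proof (rule infsum_cong_neutral)
    fix x assume "x \<in> (\<lambda>g. g <# H) ` F - lcosets H"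
    then show "(\<Sum>g\<in>F \<inter> x. cmod (f g))\<^sup>2 = 0"
      using assms(2) by (auto simp: LCOSETS_def)
  next
    fix x assume x: "x \<in> lcosets H - (\<lambda>g. g <# H) ` F"
    have "F \<inter> x = {}"
    proof (rule ccontr)
      assume "F \<inter> x \<noteq> {}"
      then obtain g where g: "g \<in> F" "g \<in> x" by auto
      from x obtain a where "a \<in> carrier G" "x = a <# H" by (auto simp: LCOSETS_def)
      then have "x = g <# H"
        using g l_repr_independence[OF _ _ subgroup_H] by auto
      then show False using x g by auto
    qed
    then show "(\<Sum>g\<in>F \<inter> x. cmod (f g))\<^sup>2 = 0" by simp
  qed auto
  then show ?thesis
    using assms(1) by (simp add: norm21_def inner L2_set_def)
qed

lemma group_algebra_sum:
  "finite A \<Longrightarrow> (\<And>i. i \<in> A \<Longrightarrow> F i \<in> group_algebra G) \<Longrightarrow> (\<lambda>g. \<Sum>i\<in>A. F i g) \<in> group_algebra G"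
proof -
  assume A: "finite A" "\<And>i. i \<in> A \<Longrightarrow> F i \<in> group_algebra G"
  have "{g. (\<Sum>i\<in>A. F i g) \<noteq> 0} \<subseteq> (\<Union>i\<in>A. {g. F i g \<noteq> 0})"
    using sum.not_neutral_contains_not_neutral by fastforce
  then show ?thesis
    using A by (auto simp: group_algebra_def intro: finite_subset)
qed

lemma norm21_triangle:
  assumes "f \<in> group_algebra G" "f' \<in> group_algebra G"
  shows "norm21 G H (\<lambda>g. f g + f' g) \<le> norm21 G H f + norm21 G H f'"
proof -
  define F where "F = {g. f g \<noteq> 0} \<union> {g. f' g \<noteq> 0}"
  have F: "finite F" "F \<subseteq> carrier G"
    using assms by (auto simp: group_algebra_def F_def)
  let ?X = "(\<lambda>g. g <# H) ` F"
  have "norm21 G H (\<lambda>g. f g + f' g) = L2_set (\<lambda>x. \<Sum>g\<in>F \<inter> x. cmod (f g + f' g)) ?X"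
    using F by (rule norm21_finite) (auto simp: F_def)
  also have "\<dots> \<le> L2_set (\<lambda>x. (\<Sum>g\<in>F \<inter> x. cmod (f g)) + (\<Sum>g\<in>F \<inter> x. cmod (f' g))) ?X"
    by (intro L2_set_mono sum_nonneg)
       (auto simp: sum.distrib[symmetric] intro!: sum_mono norm_triangle_ineq)
  also have "\<dots> \<le> L2_set (\<lambda>x. \<Sum>g\<in>F \<inter> x. cmod (f g)) ?X + L2_set (\<lambda>x. \<Sum>g\<in>F \<inter> x. cmod (f' g)) ?X"
    by (rule L2_set_triangle_ineq)
  also have "\<dots> = norm21 G H f + norm21 G H f'"
    using norm21_finite[OF F, of f] norm21_finite[OF F, of f'] by (auto simp: F_def)
  finally show ?thesis .
qed

lemma norm21_mono:
  assumes "f \<in> group_algebra G" "f' \<in> group_algebra G" "\<And>g. g \<in> carrier G \<Longrightarrow> cmod (f g) \<le> cmod (f' g)"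
  shows "norm21 G H f \<le> norm21 G H f'"
proof -
  define F where "F = {g. f g \<noteq> 0} \<union> {g. f' g \<noteq> 0}"
  have F: "finite F" "F \<subseteq> carrier G"
    using assms by (auto simp: group_algebra_def F_def)
  let ?X = "(\<lambda>g. g <# H) ` F"
  have "norm21 G H f = L2_set (\<lambda>x. \<Sum>g\<in>F \<inter> x. cmod (f g)) ?X"
    using F by (rule norm21_finite) (auto simp: F_def)
  also have "\<dots> \<le> L2_set (\<lambda>x. \<Sum>g\<in>F \<inter> x. cmod (f' g)) ?X"
    using F(2) assms(3) by (intro L2_set_mono sum_nonneg sum_mono) auto
  also have "\<dots> = norm21 G H f'"
    using F by (intro norm21_finite[symmetric]) (auto simp: F_def)
  finally show ?thesis .
qed

lemma norm21_nonneg [simp]: "0 \<le> norm21 G H f"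
  by (auto simp: norm21_def intro: infsum_nonneg)

lemma norm21_zero [simp]: "norm21 G H (\<lambda>g. 0) = 0"
  by (simp add: norm21_def)

lemma norm21_scale:
  assumes "f \<in> group_algebra G"
  shows "norm21 G H (\<lambda>g. c * f g) = cmod c * norm21 G H f"
proof -
  define F where "F = {g. f g \<noteq> 0}"
  have F: "finite F" "F \<subseteq> carrier G"
    using assms by (auto simp: group_algebra_def F_def)
  have "norm21 G H (\<lambda>g. c * f g) = L2_set (\<lambda>x. \<Sum>g\<in>F \<inter> x. cmod (c * f g)) ((\<lambda>g. g <# H) ` F)"
    using F by (rule norm21_finite) (auto simp: F_def)
  also have "\<dots> = L2_set (\<lambda>x. cmod c * (\<Sum>g\<in>F \<inter> x. cmod (f g))) ((\<lambda>g. g <# H) ` F)"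
    by (simp add: norm_mult sum_distrib_left)
  also have "\<dots> = cmod c * L2_set (\<lambda>x. \<Sum>g\<in>F \<inter> x. cmod (f g)) ((\<lambda>g. g <# H) ` F)"
    by (simp add: L2_set_right_distrib)
  also have "\<dots> = cmod c * norm21 G H f"
    using norm21_finite[OF F, of f] by (simp add: F_def)
  finally show ?thesis .
qed

lemma norm21_sum_le:
  assumes "finite A" "\<And>i. i \<in> A \<Longrightarrow> F i \<in> group_algebra G"
  shows "norm21 G H (\<lambda>g. \<Sum>i\<in>A. F i g) \<le> (\<Sum>i\<in>A. norm21 G H (F i))"
  using assms
proof (induction A)
  case (insert a A)
  have "norm21 G H (\<lambda>g. F a g + (\<Sum>i\<in>A. F i g)) \<le> norm21 G H (F a) + norm21 G H (\<lambda>g. \<Sum>i\<in>A. F i g)"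
    using insert by (intro norm21_triangle group_algebra_sum) auto
  then show ?case using insert by simp
qed simp

text \<open>The guard keeps translates in the group algebra: off the carrier the product
  \<open>inv h \<otimes> g\<close> is unspecified and might hit the support of
  \<open>f\<close>.\<close>

definition ltranslate where
  "ltranslate h f g = (if g \<in> carrier G then f (inv h \<otimes> g) else (0::complex))"

lemma ltranslate_group_algebra:
  assumes "h \<in> carrier G" "f \<in> group_algebra G"
  shows "ltranslate h f \<in> group_algebra G"
proof -
  have "{g. ltranslate h f g \<noteq> 0} \<subseteq> (\<lambda>g. h \<otimes> g) ` {g. f g \<noteq> 0}"
  proof
    fix g assume "g \<in> {g. ltranslate h f g \<noteq> 0}"
    then have g: "g \<in> carrier G" "f (inv h \<otimes> g) \<noteq> 0" by (auto simp: ltranslate_def split: if_splits)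
    then have "g = h \<otimes> (inv h \<otimes> g)" using assms(1) by (simp add: m_assoc[symmetric])
    then show "g \<in> (\<lambda>g. h \<otimes> g) ` {g. f g \<noteq> 0}" using g by blast
  qed
  moreover have "{g. ltranslate h f g \<noteq> 0} \<subseteq> carrier G"
    by (auto simp: ltranslate_def)
  ultimately show ?thesis
    using assms by (auto simp: group_algebra_def intro: finite_subset)
qed

lemma l_coset_l_coset:
  "h \<in> carrier G \<Longrightarrow> x \<in> lcosets H \<Longrightarrow> k \<in> carrier G \<Longrightarrow> k <# (h <# x) = (k \<otimes> h) <# x"
  using lcos_m_assoc subgroup.lcosets_carrier[OF subgroup_H is_group] by metis

lemma l_coset_in_lcosets:
  assumes "h \<in> carrier G" "x \<in> lcosets H"
  shows "h <# x \<in> lcosets H"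
proof -
  from assms obtain a where "a \<in> carrier G" "x = a <# H" by (auto simp: LCOSETS_def)
  then show ?thesis
    using assms(1) lcos_m_assoc[OF subgroup.subset[OF subgroup_H], of h a] by (auto simp: LCOSETS_def)
qed

text \<open>Left multiplication permutes the left cosets of \<open>H\<close> and maps each
  bijectively onto its image, so both sums are merely reindexed.\<close>

lemma norm21_ltranslate:
  assumes h: "h \<in> carrier G"
  shows "norm21 G H (ltranslate h f) = norm21 G H f"
proof -
  have car: "x \<subseteq> carrier G" if "x \<in> lcosets H" for x
    using subgroup.lcosets_carrier[OF subgroup_H is_group that] .
  have one: "\<one> <# x = x" if "x \<in> lcosets H" for x
    using car[OF that] by (force simp: l_coset_def)
  have inner: "(\<Sum>\<^sub>\<infinity>g\<in>h <# x. cmod (ltranslate h f g)) = (\<Sum>\<^sub>\<infinity>g\<in>x. cmod (f g))"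
    if "x \<in> lcosets H" for x
  proof (rule infsum_reindex_bij_witness[of _ "\<lambda>g. h \<otimes> g" "\<lambda>g. inv h \<otimes> g"])
    fix g assume "g \<in> h <# x"
    then obtain k where "k \<in> x" "g = h \<otimes> k" by (auto simp: l_coset_def)
    moreover have "k \<in> carrier G" using car[OF that] \<open>k \<in> x\<close> by auto
    ultimately show "h \<otimes> (inv h \<otimes> g) = g" "inv h \<otimes> g \<in> x"
      "cmod (f (inv h \<otimes> g)) = cmod (ltranslate h f g)"
      using h by (auto simp: m_assoc[symmetric] ltranslate_def)
  next
    fix g assume "g \<in> x"
    moreover have "g \<in> carrier G" using car[OF that] \<open>g \<in> x\<close> by auto
    ultimately show "inv h \<otimes> (h \<otimes> g) = g" "h \<otimes> g \<in> h <# x"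
      using h by (auto simp: m_assoc[symmetric] l_coset_def)
  qed
  have "(\<Sum>\<^sub>\<infinity>x\<in>lcosets H. (\<Sum>\<^sub>\<infinity>g\<in>x. cmod (f g))\<^sup>2) =
    (\<Sum>\<^sub>\<infinity>x\<in>lcosets H. (\<Sum>\<^sub>\<infinity>g\<in>x. cmod (ltranslate h f g))\<^sup>2)"
    using h by (intro infsum_reindex_bij_witness[of _ "\<lambda>x. inv h <# x" "\<lambda>x. h <# x"])
      (auto simp: l_coset_l_coset one l_coset_in_lcosets inner)
  then show ?thesis by (simp add: norm21_def)
qed

text \<open>A convolution is a combination of left translates of \<open>\<phi>\<close>, which all
  have the same norm; the triangle inequality then gives the bound by the l^1-norm of
  \<open>f\<close>.\<close>

lemma convolution_eq_sum:
  assumes "f \<in> group_algebra G"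
  shows "convolution G f \<phi> = (\<lambda>g. \<Sum>h\<in>{h. f h \<noteq> 0}. f h * ltranslate h \<phi> g)"
proof
  fix g
  show "convolution G f \<phi> g = (\<Sum>h\<in>{h. f h \<noteq> 0}. f h * ltranslate h \<phi> g)"
  proof (cases "g \<in> carrier G")
    case True
    have "(\<Sum>\<^sub>\<infinity>h\<in>carrier G. f h * \<phi> (inv h \<otimes> g)) = (\<Sum>\<^sub>\<infinity>h\<in>{h. f h \<noteq> 0}. f h * \<phi> (inv h \<otimes> g))"
      using assms by (intro infsum_cong_neutral) (auto simp: group_algebra_def)
    then show ?thesis
      using True assms by (simp add: convolution_def ltranslate_def group_algebra_def)
  qed (simp add: convolution_def ltranslate_def)
qed

lemma group_algebra_scale: "f \<in> group_algebra G \<Longrightarrow> (\<lambda>g. c * f g) \<in> group_algebra G"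
  by (auto simp: group_algebra_def intro: rev_finite_subset)

lemma group_algebra_mult: "f \<in> group_algebra G \<Longrightarrow> (\<lambda>g. f g * w g) \<in> group_algebra G"
  by (auto simp: group_algebra_def intro: rev_finite_subset)

lemma convolution_group_algebra:
  assumes "f \<in> group_algebra G" "\<phi> \<in> group_algebra G"
  shows "convolution G f \<phi> \<in> group_algebra G"
  unfolding convolution_eq_sum[OF assms(1)]
  using assms by (intro group_algebra_sum group_algebra_scale ltranslate_group_algebra)
    (auto simp: group_algebra_def)

lemma norm21_convolution_le:
  assumes "f \<in> group_algebra G" "\<phi> \<in> group_algebra G"
  shows "norm21 G H (convolution G f \<phi>) \<le> (\<Sum>h\<in>{h. f h \<noteq> 0}. cmod (f h)) * norm21 G H \<phi>"
proof -
  have car: "h \<in> carrier G" if "f h \<noteq> 0" for h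
    using assms(1) that by (auto simp: group_algebra_def)
  have "norm21 G H (convolution G f \<phi>) \<le> (\<Sum>h\<in>{h. f h \<noteq> 0}. norm21 G H (\<lambda>g. f h * ltranslate h \<phi> g))"
    unfolding convolution_eq_sum[OF assms(1)]
    using assms car by (intro norm21_sum_le group_algebra_scale ltranslate_group_algebra)
      (auto simp: group_algebra_def)
  also have "\<dots> = (\<Sum>h\<in>{h. f h \<noteq> 0}. cmod (f h) * norm21 G H \<phi>)"
    using car assms by (intro sum.cong refl)
      (simp add: norm21_scale norm21_ltranslate ltranslate_group_algebra)
  finally show ?thesis by (simp add: sum_distrib_right)
qed

lemma group_algebra_of_bool:
  "finite F \<Longrightarrow> F \<subseteq> carrier G \<Longrightarrow> (\<lambda>g. of_bool (g \<in> F)) \<in> group_algebra G"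
  by (auto simp: group_algebra_def)

lemma norm21_of_bool:
  assumes "finite F" "F \<subseteq> carrier G" "inj_on (\<lambda>g. g <# H) F"
  shows "norm21 G H (\<lambda>g. of_bool (g \<in> F)) = sqrt (card F)"
proof -
  have "F \<inter> (g <# H) = {g}" if "g \<in> F" for g
    using that assms(2,3) mem_lcoset_iff_eq unfolding inj_on_def by blast
  then have "L2_set (\<lambda>x. \<Sum>g\<in>F \<inter> x. cmod (of_bool (g \<in> F))) ((\<lambda>g. g <# H) ` F) = L2_set (\<lambda>x. 1) ((\<lambda>g. g <# H) ` F)"
    by (intro L2_set_cong) auto
  then show ?thesis
    using assms by (subst norm21_finite[of F]) (auto simp: L2_set_constant card_image)
qed

lemma norm_h_set_bdd_above:
  assumes "f \<in> group_algebra G"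
  shows "bdd_above {norm21 G H (convolution G f \<phi>) | \<phi>. \<phi> \<in> group_algebra G \<and> norm21 G H \<phi> = 1}"
  using norm21_convolution_le[OF assms]
  by (intro bdd_aboveI[of _ "\<Sum>h\<in>{h. f h \<noteq> 0}. cmod (f h)"]) fastforce

lemma norm_h_le_l1:
  assumes "f \<in> group_algebra G"
  shows "norm_h G H f \<le> (\<Sum>h\<in>{h. f h \<noteq> 0}. cmod (f h))"
  unfolding norm_h_def
proof (rule cSup_least)
  have "(\<lambda>g. of_bool (g \<in> {\<one>})) \<in> group_algebra G" "norm21 G H (\<lambda>g. of_bool (g \<in> {\<one>})) = 1"
    using group_algebra_of_bool[of "{\<one>}"] norm21_of_bool[of "{\<one>}"] by auto
  then show "{norm21 G H (convolution G f \<phi>) | \<phi>. \<phi> \<in> group_algebra G \<and> norm21 G H \<phi> = 1} \<noteq> {}"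
    by blast
qed (use norm21_convolution_le[OF assms] in fastforce)

lemma norm21_convolution_le_norm_h:
  assumes f: "f \<in> group_algebra G" and \<phi>: "\<phi> \<in> group_algebra G" and pos: "norm21 G H \<phi> > 0"
  shows "norm21 G H (convolution G f \<phi>) \<le> norm_h G H f * norm21 G H \<phi>"
proof -
  define r where "r = norm21 G H \<phi>"
  define \<psi> where "\<psi> = (\<lambda>g. of_real (1 / r) * \<phi> g)"
  have \<psi>: "\<psi> \<in> group_algebra G" "norm21 G H \<psi> = 1"
    using group_algebra_scale[OF \<phi>, of "of_real (1 / r)"] norm21_scale[OF \<phi>, of "of_real (1 / r)"] pos
    unfolding \<psi>_def r_def by (auto simp: norm_divide)
  have "convolution G f \<psi> = (\<lambda>g. of_real (1 / r) * convolution G f \<phi> g)"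
    unfolding convolution_eq_sum[OF f] \<psi>_def ltranslate_def
    by (auto simp: fun_eq_iff sum_distrib_left intro!: sum.cong)
  then have "norm21 G H (convolution G f \<psi>) = norm21 G H (convolution G f \<phi>) / r"
    using norm21_scale[OF convolution_group_algebra[OF f \<phi>], of "of_real (1 / r)"] pos
    by (simp add: r_def norm_divide)
  moreover have "norm21 G H (convolution G f \<psi>) \<le> norm_h G H f"
    unfolding norm_h_def using \<psi> by (intro cSup_upper norm_h_set_bdd_above f) auto
  ultimately have "norm21 G H (convolution G f \<phi>) / r \<le> norm_h G H f"
    by simp
  then show ?thesis
    using pos by (simp add: r_def pos_divide_le_eq)
qed

text \<open>Cauchy-Schwarz against the constant 1 over the cosets that meet the support.\<close>

lemma l1_le_norm21_if_finite_index:
  assumes fin: "finite (lcosets H)" and f: "f \<in> group_algebra G"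
  shows "(\<Sum>h\<in>{h. f h \<noteq> 0}. cmod (f h)) \<le> sqrt (card (lcosets H)) * norm21 G H f"
proof -
  define F where "F = {h. f h \<noteq> 0}"
  define Q where "Q = (\<lambda>g. g <# H) ` F"
  have F: "finite F" "F \<subseteq> carrier G"
    using f by (auto simp: group_algebra_def F_def)
  have Q: "Q \<subseteq> lcosets H" "finite Q"
    using F by (auto simp: Q_def LCOSETS_def)
  have fib: "{g \<in> F. g <# H = x} = F \<inter> x" if "x \<in> Q" for x
    using that F(2) mem_lcoset_iff_eq unfolding Q_def by blast
  have "(\<Sum>h\<in>F. cmod (f h)) = (\<Sum>x\<in>Q. \<Sum>g\<in>{g \<in> F. g <# H = x}. cmod (f g))"
    using F(1) Q_def by (intro sum.group[symmetric]) auto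
  also have "\<dots> = (\<Sum>x\<in>Q. \<bar>1\<bar> * \<bar>\<Sum>g\<in>F \<inter> x. cmod (f g)\<bar>)"
    using fib by (intro sum.cong) (auto simp: sum_nonneg)
  also have "\<dots> \<le> L2_set (\<lambda>x. 1) Q * L2_set (\<lambda>x. \<Sum>g\<in>F \<inter> x. cmod (f g)) Q"
    by (rule L2_set_mult_ineq)
  also have "L2_set (\<lambda>x. \<Sum>g\<in>F \<inter> x. cmod (f g)) Q = norm21 G H f"
    using norm21_finite[OF F, of f] by (simp add: Q_def F_def)
  also have "L2_set (\<lambda>x. 1) Q * norm21 G H f \<le> sqrt (card (lcosets H)) * norm21 G H f"
    using Q fin by (intro mult_right_mono) (auto simp: L2_set_constant card_mono)
  finally show ?thesis by (simp add: F_def)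
qed

end

section \<open>Word length and weights\<close>

locale group_with_generators = group G for G (structure) +
  fixes S
  assumes finite_S: "finite S" and gen_S: "symmetric_generating_set G S"
begin

abbreviation len where "len \<equiv> word_length G S"

lemma S_closed: "S \<subseteq> carrier G" "s \<in> S \<Longrightarrow> inv s \<in> S"
  using gen_S by (auto simp: symmetric_generating_set_def)

lemma word_exists:
  assumes "g \<in> carrier G"
  shows "\<exists>xs. length xs = len g \<and> set xs \<subseteq> S \<and> foldr (\<otimes>) xs \<one> = g"
proof -
  obtain xs where "set xs \<subseteq> S" "foldr (\<otimes>) xs \<one> = g"
    using generate_eq_foldr[OF S_closed(1) S_closed(2)] gen_S assms
    by (auto simp: symmetric_generating_set_def)
  then have "\<exists>k xs. length xs = k \<and> set xs \<subseteq> S \<and> foldr (\<otimes>) xs \<one> = g"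
    by blast
  then show ?thesis
    unfolding word_length_def by (rule LeastI_ex)
qed

lemma len_le: "set xs \<subseteq> S \<Longrightarrow> len (foldr (\<otimes>) xs \<one>) \<le> length xs"
  unfolding word_length_def by (intro Least_le exI[of _ xs]) auto

lemma len_one [simp]: "len \<one> = 0"
  using len_le[of "[]"] by simp

lemma len_mult:
  assumes "g \<in> carrier G" "h \<in> carrier G"
  shows "len (g \<otimes> h) \<le> len g + len h"
proof -
  obtain xs ys where "length xs = len g" "set xs \<subseteq> S" "foldr (\<otimes>) xs \<one> = g"
    "length ys = len h" "set ys \<subseteq> S" "foldr (\<otimes>) ys \<one> = h"
    using word_exists assms by meson
  then show ?thesis
    using len_le[of "xs @ ys"] foldr_mult_append[of xs ys] S_closed(1) by auto
qed

lemma len_inv: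
  assumes "g \<in> carrier G"
  shows "len (inv g) \<le> len g"
proof -
  obtain xs where xs: "length xs = len g" "set xs \<subseteq> S" "foldr (\<otimes>) xs \<one> = g"
    using word_exists assms by meson
  have *: "inv (foldr (\<otimes>) xs \<one>) = foldr (\<otimes>) (rev (map (\<lambda>s. inv s) xs)) \<one>" if "set xs \<subseteq> S" for xs
    using that
  proof (induction xs)
    case (Cons s xs)
    have *: "set xs \<subseteq> carrier G" "s \<in> carrier G" "set (rev (map (\<lambda>s. inv s) xs)) \<subseteq> carrier G"
      using Cons.prems S_closed(1) by auto
    then show ?case
      using Cons foldr_mult_append[of "rev (map (\<lambda>s. inv s) xs)" "[inv s]"] inv_mult_group
      by simp
  qed simp
  have "set (rev (map (\<lambda>s. inv s) xs)) \<subseteq> S"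
    using xs(2) S_closed(2) by auto
  then show ?thesis
    using len_le[of "rev (map (\<lambda>s. inv s) xs)"] xs *[OF xs(2)] by simp
qed

lemma len_pow:
  assumes "g \<in> carrier G"
  shows "len (g [^] (k::nat)) \<le> k * len g"
proof (induction k)
  case (Suc k)
  then show ?case using len_mult[of "g [^] k" g] assms by simp
qed simp

lemma finite_ball: "finite {g \<in> carrier G. len g \<le> k}"
proof (rule finite_surj[of "{xs. set xs \<subseteq> S \<and> length xs \<le> k}"])
  show "finite {xs. set xs \<subseteq> S \<and> length xs \<le> k}"
    by (intro finite_lists_length_le finite_S)
  show "{g \<in> carrier G. len g \<le> k} \<subseteq> (\<lambda>xs. foldr (\<otimes>) xs \<one>) ` {xs. set xs \<subseteq> S \<and> length xs \<le> k}"
  proof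
    fix g assume "g \<in> {g \<in> carrier G. len g \<le> k}"
    then show "g \<in> (\<lambda>xs. foldr (\<otimes>) xs \<one>) ` {xs. set xs \<subseteq> S \<and> length xs \<le> k}"
      using word_exists[of g] by force
  qed
qed

text \<open>Balls are finite, so the real supremum is taken over a bounded set, whatever the
  weight.\<close>

lemma weight_le_weight_growth:
  assumes "g \<in> carrier G" "real (len g) \<le> t"
  shows "w g \<le> weight_growth G len w t"
proof -
  have "{w g | g. g \<in> carrier G \<and> real (len g) \<le> t} \<subseteq> w ` {g \<in> carrier G. len g \<le> nat \<lfloor>t\<rfloor>}"
    by (auto simp: le_nat_floor)
  then have "bdd_above {w g | g. g \<in> carrier G \<and> real (len g) \<le> t}"
    using finite_ball finite_subset by (intro bdd_above_finite) blast
  then show ?thesis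
    unfolding weight_growth_def using assms by (intro cSup_upper) auto
qed

lemma SLC_subexp_if_pair_rapid_decay:
  assumes "pair_rapid_decay G H len"
  shows "SLC_subexp G H len"
proof -
  obtain C s :: real where Cs: "C > 0" "s > 0"
    "\<forall>f\<in>group_algebra G. norm_h G H f \<le> C * norm21 G H (\<lambda>g. f g * of_real ((1 + real (len g)) powr s))"
    using assms unfolding pair_rapid_decay_def by blast
  define w where "w g = (1 + real (len g)) powr s" for g
  have w1: "w g \<ge> 1" for g
    using Cs(2) by (auto simp: w_def ge_one_powr_ge_zero)
  \<comment> \<open>The identity lies in every ball. This keeps the logarithm nonnegative for the
    squeeze.\<close>
  have lower: "1 \<le> weight_growth G len w t" if "t > 0" for t
    using weight_le_weight_growth[of \<one> t w] w1[of \<one>] that by simp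
  have upper: "weight_growth G len w t \<le> (1 + t) powr s" if "t > 0" for t
    unfolding weight_growth_def
  proof (rule cSup_least)
    show "{w g |g. g \<in> carrier G \<and> real (len g) \<le> t} \<noteq> {}"
      using that by (auto intro!: exI[of _ \<one>])
    show "x \<le> (1 + t) powr s" if "x \<in> {w g |g. g \<in> carrier G \<and> real (len g) \<le> t}" for x
      using that Cs(2) by (auto simp: w_def intro!: powr_mono2)
  qed
  have "((\<lambda>t. ln (weight_growth G len w t) / t) \<longlongrightarrow> 0) at_top"
  proof (rule tendsto_sandwich[of "\<lambda>_. 0" _ _ "\<lambda>t. s * ln (1 + t) / t"])
    show "\<forall>\<^sub>F t in at_top. 0 \<le> ln (weight_growth G len w t) / t"
      using eventually_gt_at_top[of 0] by eventually_elim (use lower in auto)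
    show "\<forall>\<^sub>F t in at_top. ln (weight_growth G len w t) / t \<le> s * ln (1 + t) / t"
      using eventually_gt_at_top[of 0]
    proof eventually_elim
      case (elim t)
      have "ln (weight_growth G len w t) \<le> ln ((1 + t) powr s)"
        using lower[OF elim] upper[OF elim] by (intro ln_mono) auto
      then show ?case
        using elim by (intro divide_right_mono) (auto simp: ln_powr)
    qed
    show "((\<lambda>t. s * ln (1 + t) / t) \<longlongrightarrow> 0) at_top"
      by real_asymp
  qed simp
  then show ?thesis
    unfolding SLC_subexp_def using Cs w1 by (intro exI[of _ C] exI[of _ w]) (auto simp: w_def)
qed

lemma pair_rapid_decay_if_finite_index:
  assumes H: "subgroup H G" and fin: "finite_index G H"
  shows "pair_rapid_decay G H len"
proof -
  interpret group_with_subgroup G H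
    by (intro group_with_subgroup.intro group_with_subgroup_axioms.intro is_group H)
  define C where "C = sqrt (card (lcosets H))"
  have finL: "finite (lcosets H)"
    using fin by (simp add: finite_index_def)
  have "lcosets H \<noteq> {}"
    by (auto simp: LCOSETS_def)
  then have C: "C > 0"
    using finL by (simp add: C_def card_gt_0_iff)
  \<comment> \<open>Exponent 1 is an arbitrary positive choice: the constant already works for the
    unweighted norm, and the weight only enlarges the right-hand side.\<close>
  have "norm_h G H f \<le> C * norm21 G H (\<lambda>g. f g * of_real ((1 + real (len g)) powr 1))"
    if f: "f \<in> group_algebra G" for f
  proof -
    have "norm_h G H f \<le> C * norm21 G H f"
      using norm_h_le_l1[OF f] l1_le_norm21_if_finite_index[OF finL f] by (simp add: C_def)
    also have "\<dots> \<le> C * norm21 G H (\<lambda>g. f g * of_real ((1 + real (len g)) powr 1))"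
    proof (intro mult_left_mono norm21_mono group_algebra_mult f)
      fix g
      have "cmod (f g) * 1 \<le> cmod (f g) * cmod (of_real ((1 + real (len g)) powr 1))"
        by (intro mult_left_mono) (simp_all only: norm_of_real, simp_all)
      then show "cmod (f g) \<le> cmod (f g * of_real ((1 + real (len g)) powr 1))"
        by (simp only: norm_mult mult_1_right)
    qed (use C in auto)
    finally show ?thesis .
  qed
  then show ?thesis
    unfolding pair_rapid_decay_def using C by (intro exI[of _ C] exI[of _ 1]) auto
qed

end

text \<open>A Foelner argument along the powers of \<open>u\<close>: convolving the indicator of the
  first \<open>K\<close> powers with that of the first \<open>2*K\<close> gives the value
  \<open>K\<close> at \<open>K\<close> consecutive powers. The quotient of norms is at least
  \<open>K * sqrt K / sqrt (2*K)\<close>.\<close>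

lemma (in group_with_subgroup) norm_h_powers_ge:
  fixes u and K :: nat
  assumes u: "u \<in> carrier G" and inf: "\<And>m::nat. m > 0 \<Longrightarrow> u [^] m \<notin> H" and "K > 0"
  shows "real K \<le> sqrt 2 * norm_h G H (\<lambda>g. of_bool (g \<in> (\<lambda>k. u [^] k) ` {..<K}))"
    and "norm21 G H (\<lambda>g. of_bool (g \<in> (\<lambda>k. u [^] k) ` {..<K})) = sqrt K"
    and "(\<lambda>g. of_bool (g \<in> (\<lambda>k. u [^] k) ` {..<K})) \<in> group_algebra G"
proof -
  define p where "p A = (\<lambda>k::nat. u [^] k) ` A" for A
  \<comment> \<open>On functions supported on these powers every coset sum has at most one term, so
    the (2,1)-norm is an l^2-norm there.\<close>
  have inj_coset: "inj (\<lambda>k::nat. (u [^] k) <# H)"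
  proof (rule linorder_injI)
    fix j k :: nat assume "j < k"
    then have "inv (u [^] j) \<otimes> u [^] k = u [^] (k - j)"
      using u nat_pow_mult[OF u, of j "k - j"] by (metis inv_solve_left' less_imp_add_positive
          add_diff_cancel_left' nat_pow_closed)
    then show "(u [^] j) <# H \<noteq> (u [^] k) <# H"
      using lcoset_eq_iff[of "u [^] j" "u [^] k"] u inf[of "k - j"] \<open>j < k\<close> by auto
  qed
  then have inj: "inj (\<lambda>k::nat. u [^] k)"
    by (auto simp: inj_def)
  have p: "finite (p A)" "p A \<subseteq> carrier G" "inj_on (\<lambda>g. g <# H) (p A)" "card (p A) = card A"
    if "finite A" for A
    using that u inj_coset card_image[OF inj_on_subset[OF inj], of A]
    by (auto simp: p_def inj_on_def inj_def)
  have norm_p: "norm21 G H (\<lambda>g. of_bool (g \<in> p A)) = sqrt (card A)" if "finite A" for A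
    using norm21_of_bool[OF p(1-3)[OF that]] p(4)[OF that] by simp
  have ga: "(\<lambda>g. of_bool (g \<in> p A)) \<in> group_algebra G" if "finite A" for A
    using group_algebra_of_bool[OF p(1,2)[OF that]] .
  define f \<phi> where "f = (\<lambda>g. of_bool (g \<in> p {..<K}) :: complex)"
    and "\<phi> = (\<lambda>g. of_bool (g \<in> p {..<2*K}) :: complex)"
  have fga: "f \<in> group_algebra G" "\<phi> \<in> group_algebra G"
    unfolding f_def \<phi>_def by (auto intro: ga)
  \<comment> \<open>In this window every difference \<open>k - j\<close> with \<open>j < K\<close>
    stays below \<open>2*K\<close>, so all \<open>K\<close> translates contribute 1.\<close>
  have conv: "convolution G f \<phi> (u [^] k) = of_nat K" if k: "K \<le> k" "k < 2 * K" for k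
  proof -
    have "convolution G f \<phi> (u [^] k) = (\<Sum>h\<in>p {..<K}. ltranslate h \<phi> (u [^] k))"
      unfolding convolution_eq_sum[OF fga(1)] by (intro sum.cong) (auto simp: f_def)
    also have "\<dots> = (\<Sum>j<K. ltranslate (u [^] j) \<phi> (u [^] k))"
      unfolding p_def using inj by (subst sum.reindex) (auto simp: inj_def inj_on_def)
    also have "\<dots> = (\<Sum>j<K. 1)"
    proof (intro sum.cong refl)
      fix j assume "j \<in> {..<K}"
      then have "j \<le> k" using k by auto
      then have "inv (u [^] j) \<otimes> u [^] k = u [^] (k - j)"
        using u nat_pow_mult[OF u, of j "k - j"] by (metis inv_solve_left' le_add_diff_inverse
          nat_pow_closed)
      moreover have "u [^] (k - j) \<in> p {..<2*K}"
        using k by (auto simp: p_def)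
      ultimately show "ltranslate (u [^] j) \<phi> (u [^] k) = 1"
        using u by (simp add: ltranslate_def \<phi>_def)
    qed
    finally show ?thesis by simp
  qed
  have "real K * sqrt K = cmod (of_nat K) * norm21 G H (\<lambda>g. of_bool (g \<in> p {K..<2*K}))"
    by (simp add: norm_p)
  also have "\<dots> = norm21 G H (\<lambda>g. of_nat K * of_bool (g \<in> p {K..<2*K}))"
    by (rule norm21_scale[symmetric]) (rule ga, simp)
  also have "\<dots> \<le> norm21 G H (convolution G f \<phi>)"
    using conv by (intro norm21_mono group_algebra_scale ga convolution_group_algebra fga)
      (auto simp: p_def)
  also have "\<dots> \<le> norm_h G H f * norm21 G H \<phi>"
    using norm_p[of "{..<2*K}"] \<open>K > 0\<close> by (intro norm21_convolution_le_norm_h fga) (simp add: \<phi>_def)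
  also have "\<dots> = (sqrt 2 * norm_h G H f) * sqrt K"
    using norm_p[of "{..<2*K}"] by (simp add: \<phi>_def real_sqrt_mult)
  finally have "real K \<le> sqrt 2 * norm_h G H f"
    using \<open>K > 0\<close> by simp
  then show "real K \<le> sqrt 2 * norm_h G H (\<lambda>g. of_bool (g \<in> (\<lambda>k. u [^] k) ` {..<K}))"
    by (simp add: f_def p_def)
  show "norm21 G H (\<lambda>g. of_bool (g \<in> (\<lambda>k. u [^] k) ` {..<K})) = sqrt K"
    using norm_p[of "{..<K}"] by (simp add: p_def)
  show "(\<lambda>g. of_bool (g \<in> (\<lambda>k. u [^] k) ` {..<K})) \<in> group_algebra G"
    using ga[of "{..<K}"] by (simp add: p_def)
qed

text \<open>If no positive power of \<open>u\<close> were in \<open>H\<close>, the powers of \<open>u\<close> would lie in distinct cosets and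
  behave like the amenable group of integers, where \<open>norm_h\<close> of a nonnegative function is its
  \<open>l\<^sup>1\<close>-norm. Exponential distortion of the powers then contradicts subexponential growth.\<close>

lemma (in group_with_generators) SLC_subexp_imp_power_mem:
  assumes H: "subgroup H G" and slc: "SLC_subexp G H len" and u: "u \<in> carrier G"
    and distorted: "\<And>L y. y < 2 ^ L \<Longrightarrow> len (u [^] (y::nat)) \<le> c * L"
  shows "\<exists>m>0. u [^] (m::nat) \<in> H"
proof (rule ccontr)
  assume "\<not> ?thesis"
  then have inf: "\<And>m::nat. m > 0 \<Longrightarrow> u [^] m \<notin> H" by blast
  interpret group_with_subgroup G H
    by (intro group_with_subgroup.intro group_with_subgroup_axioms.intro is_group H)
  obtain C w where C: "C > 0" and w: "\<And>g. g \<in> carrier G \<Longrightarrow> w g \<ge> (1::real)"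
    and bound: "\<And>f. f \<in> group_algebra G \<Longrightarrow> norm_h G H f \<le> C * norm21 G H (\<lambda>g. f g * of_real (w g))"
    and growth: "((\<lambda>t. ln (weight_growth G len w t) / t) \<longlongrightarrow> 0) at_top"
    using slc unfolding SLC_subexp_def by blast
  \<comment> \<open>\<open>Suc c\<close> instead of \<open>c\<close> makes the radius tend to
    infinity even if \<open>c = 0\<close>.\<close>
  define W where "W L = weight_growth G len w (real (Suc c) * real L)" for L
  have W1: "W L \<ge> 1" for L
    using weight_le_weight_growth[of \<one> "real (Suc c) * real L" w] w[of \<one>] by (simp add: W_def)
  \<comment> \<open>Comparing \<open>2 ^ L\<close> with
    \<open>sqrt 2 * C * W L * sqrt (2 ^ L)\<close> shows that the weight grows at least like the
    square root of \<open>2 ^ L\<close>.\<close>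
  have main: "sqrt (2 ^ L) \<le> sqrt 2 * C * W L" for L
  proof -
    define f where "f = (\<lambda>g. of_bool (g \<in> (\<lambda>k. u [^] k) ` {..<(2::nat) ^ L}) :: complex)"
    note K = norm_h_powers_ge[OF u inf, where K = "2 ^ L", simplified, folded f_def]
    have "norm21 G H (\<lambda>g. f g * of_real (w g)) \<le> norm21 G H (\<lambda>g. of_real (W L) * f g)"
    proof (rule norm21_mono[OF group_algebra_mult[OF K(3)] group_algebra_scale[OF K(3)]])
      fix g assume g: "g \<in> carrier G"
      show "cmod (f g * of_real (w g)) \<le> cmod (of_real (W L) * f g)"
      proof (cases "g \<in> (\<lambda>k. u [^] k) ` {..<(2::nat) ^ L}")
        case True
        then obtain k :: nat where "k < 2 ^ L" "g = u [^] k" by blast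
        then have "len g \<le> c * L"
          using distorted[of k L] by simp
        then have "real (len g) \<le> real (c * L)"
          by (rule of_nat_mono)
        then have "real (len g) \<le> real (Suc c) * real L"
          by (simp add: algebra_simps)
        then show ?thesis
          using weight_le_weight_growth[OF g] w[OF g] W1[of L] True
          by (simp add: f_def W_def norm_mult)
      qed (simp add: f_def)
    qed
    also have "\<dots> = W L * sqrt (2 ^ L)"
      using norm21_scale[OF K(3), of "of_real (W L)"] K(2) W1[of L] by simp
    finally have "norm_h G H f \<le> C * (W L * sqrt (2 ^ L))"
      using bound[OF K(3)] C by (meson mult_le_cancel_left_pos order_trans)
    then have "2 ^ L \<le> sqrt 2 * (C * (W L * sqrt (2 ^ L)))"
      using K(1) by (meson mult_le_cancel_left_pos order_trans real_sqrt_gt_zero zero_less_numeral)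
    then have "sqrt (2 ^ L) * sqrt (2 ^ L) \<le> (sqrt 2 * C * W L) * sqrt (2 ^ L)"
      by (simp add: mult_ac)
    then show ?thesis by (simp only: mult_le_cancel_right) auto
  qed
  \<comment> \<open>After logarithms and division by the radius the left side is a positive
    constant, while the right side tends to 0.\<close>
  have le: "ln 2 / (2 * real (Suc c)) \<le> ln (sqrt 2 * C) / (real (Suc c) * real L) + ln (W L) / (real (Suc c) * real L)" if "L > 0" for L :: nat
  proof -
    have "ln (sqrt (2 ^ L)) \<le> ln (sqrt 2 * C * W L)"
      using main[of L] by (intro ln_mono) auto
    then have "real L * ln 2 / 2 \<le> ln (sqrt 2 * C) + ln (W L)"
      using C W1[of L] ln_mult_pos[of "sqrt 2 * C" "W L"] by (simp add: ln_sqrt ln_realpow)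
    then have "real L * ln 2 / 2 / (real (Suc c) * real L) \<le> (ln (sqrt 2 * C) + ln (W L)) / (real (Suc c) * real L)"
      by (intro divide_right_mono) auto
    moreover have "real L * ln 2 / 2 / (real (Suc c) * real L) = ln 2 / (2 * real (Suc c))"
      using that by (simp del: of_nat_Suc)
    ultimately show ?thesis
      by (simp only: add_divide_distrib)
  qed
  have "(\<lambda>L. ln (sqrt 2 * C) / (real (Suc c) * real L) + ln (W L) / (real (Suc c) * real L)) \<longlonglongrightarrow> 0 + 0"
  proof (rule tendsto_add)
    have lim: "filterlim (\<lambda>L. real (Suc c) * real L) at_top sequentially"
      by (intro filterlim_tendsto_pos_mult_at_top[OF tendsto_const] filterlim_real_sequentially) simp
    show "(\<lambda>L. ln (sqrt 2 * C) / (real (Suc c) * real L)) \<longlonglongrightarrow> 0"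
      using lim by (intro tendsto_divide_0[OF tendsto_const] filterlim_at_top_imp_at_infinity)
    show "(\<lambda>L. ln (W L) / (real (Suc c) * real L)) \<longlonglongrightarrow> 0"
      using filterlim_compose[OF growth lim] by (simp add: W_def)
  qed
  then have "ln 2 / (2 * real (Suc c)) \<le> (0::real)"
    using le by (intro LIMSEQ_le_const[of _ "0::real"]) (auto intro!: exI[of _ 1])
  then show False by (simp add: field_simps)
qed

section \<open>Finite index via quotients\<close>

lemma (in group) rcos_mult_left:
  assumes "subgroup N G" "x \<in> N" "b \<in> carrier G"
  shows "N #> (x \<otimes> b) = N #> b"
  using assms coset_mult_assoc[of N x b] coset_join2[of x N] subgroup.subset[of N G]
    subgroup.mem_carrier[of N G x] by simp

text \<open>The commutator of \<open>x\<close> and \<open>t\<close> lies in \<open>N\<close> by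
  normality. Transvections may thus be conjugated by elements of \<open>N\<close> without leaving
  their coset.\<close>

lemma (in group) rcos_conj:
  assumes "N \<lhd> G" "x \<in> N" "t \<in> carrier G"
  shows "N #> (x \<otimes> t \<otimes> inv x) = N #> t"
proof -
  interpret N: normal N G by fact
  have x: "x \<in> carrier G" using assms(2) by (rule N.mem_carrier)
  have "t \<otimes> inv x \<otimes> inv t \<in> N"
    using assms N.inv_op_closed2[of t "inv x"] by simp
  then have "x \<otimes> (t \<otimes> inv x \<otimes> inv t) \<in> N"
    using assms(2) by simp
  moreover have "x \<otimes> t \<otimes> inv x = x \<otimes> (t \<otimes> inv x \<otimes> inv t) \<otimes> t"
    using x assms(3) by (simp add: m_assoc)
  ultimately show ?thesis
    using rcos_mult_left[of N "x \<otimes> (t \<otimes> inv x \<otimes> inv t)" t] N.subgroup_axioms assms(3) by simp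
qed

text \<open>Dietzmann's lemma is applied to the image of \<open>T\<close> in the quotient by
  \<open>N\<close>, where it is finite, closed under conjugation, of exponent \<open>q\<close>, and
  generates everything.\<close>

lemma (in group) finite_lcosets_if_generated_mod_normal:
  assumes N: "N \<lhd> G" and H: "subgroup H G" "N \<subseteq> H"
    and T: "T \<subseteq> carrier G" "generate G T = carrier G"
    and conj: "\<And>g t. g \<in> carrier G \<Longrightarrow> t \<in> T \<Longrightarrow> g \<otimes> t \<otimes> inv g \<in> T"
    and inverse: "\<And>t. t \<in> T \<Longrightarrow> inv t \<in> T"
    and exponent: "\<And>t. t \<in> T \<Longrightarrow> t [^] (q::nat) \<in> N" and q: "q > 0"
    and fin: "finite ((\<lambda>t. N #> t) ` T)"
  shows "finite (lcosets H)"
proof -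
  interpret N: normal N G by fact
  interpret Q: group "G Mod N" by (rule N.factorgroup_is_group)
  define h where "h = (\<lambda>t. N #> t)"
  have hom: "h \<in> hom G (G Mod N)"
    unfolding h_def by (rule N.r_coset_hom_Mod)
  interpret h: group_hom G "G Mod N" h
    by unfold_locales (rule hom)
  have "finite (generate (G Mod N) (h ` T))"
  proof (rule Q.finite_generate_if_conj_closed[where q = q])
    show "h ` T \<subseteq> carrier (G Mod N)"
      using T(1) h.hom_closed by blast
    show "finite (h ` T)"
      using fin by (simp add: h_def)
    show "inv\<^bsub>G Mod N\<^esub> x \<in> h ` T" if "x \<in> h ` T" for x
      using that T(1) inverse h.hom_inv by (metis (no_types, lifting) imageE imageI subsetD)
    show "inv\<^bsub>G Mod N\<^esub> x \<otimes>\<^bsub>G Mod N\<^esub> y \<otimes>\<^bsub>G Mod N\<^esub> x \<in> h ` T" if xy: "x \<in> h ` T" "y \<in> h ` T" for x y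
    proof -
      obtain s t where st: "s \<in> T" "t \<in> T" "x = h s" "y = h t"
        using xy by blast
      then have c: "s \<in> carrier G" "t \<in> carrier G" using T(1) by auto
      have "inv s \<otimes> t \<otimes> s \<in> T"
        using conj[of "inv s" t] c st by simp
      moreover have "h (inv s \<otimes> t \<otimes> s) = inv\<^bsub>G Mod N\<^esub> x \<otimes>\<^bsub>G Mod N\<^esub> y \<otimes>\<^bsub>G Mod N\<^esub> x"
        using c st by simp
      ultimately show ?thesis by (metis imageI)
    qed
    show "x [^]\<^bsub>G Mod N\<^esub> q = \<one>\<^bsub>G Mod N\<^esub>" if x: "x \<in> h ` T" for x
    proof -
      obtain t where t: "t \<in> T" "x = h t" using x by blast
      then have "x [^]\<^bsub>G Mod N\<^esub> q = h (t [^] q)"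
        using T(1) h.hom_nat_pow[of t q] by auto
      also have "\<dots> = N"
        unfolding h_def using exponent[OF t(1)] N.rcos_const[OF is_group] by simp
      finally show ?thesis by (simp add: FactGroup_def)
    qed
  qed (rule q)
  also have "generate (G Mod N) (h ` T) = h ` carrier G"
    using h.generate_img[OF T(1)] T(2) by simp
  also have "h ` carrier G = carrier (G Mod N)"
    by (auto simp: h_def FactGroup_def RCOSETS_def)
  finally show ?thesis
    using finite_lcosets_if_finite_FactGroup[OF N H] by blast
qed

lemma finite_image_if_factors:
  assumes "finite (red ` A)" "\<And>a b. a \<in> A \<Longrightarrow> b \<in> A \<Longrightarrow> red a = red b \<Longrightarrow> f a = f b"
  shows "finite (f ` A)"
proof -
  obtain C where C: "C \<subseteq> A" "finite C" "red ` A = red ` C"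
    using assms(1) by (meson finite_subset_image subset_refl)
  have "f ` A \<subseteq> f ` C"
  proof
    fix y assume "y \<in> f ` A"
    then obtain a where a: "a \<in> A" "y = f a" by blast
    then obtain c where "c \<in> C" "red a = red c" using C(3) by blast
    then show "y \<in> f ` C" using a assms(2) C(1) by blast
  qed
  then show ?thesis using C(2) finite_surj by blast
qed

text \<open>Take for \<open>t\<close> the product of the primes of \<open>c\<close> that do not
  divide \<open>a\<close>. A prime of \<open>c\<close> not dividing \<open>a\<close> divides
  \<open>t\<close>, hence not the sum; one dividing \<open>a\<close> divides neither
  \<open>t\<close> nor \<open>b\<close>.\<close>

lemma exists_coprime_add_mult:
  fixes a b c :: int
  assumes "c \<noteq> 0" and cop: "\<And>p. prime p \<Longrightarrow> p dvd a \<Longrightarrow> p dvd b \<Longrightarrow> p dvd c \<Longrightarrow> False"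
  shows "\<exists>t. coprime (a + t * b) c"
proof -
  define P where "P = {p \<in> prime_factors c. \<not> p dvd a}"
  have P: "finite P" by (simp add: P_def)
  define t where "t = \<Prod>P"
  have "\<not> (p dvd a + t * b \<and> p dvd c)" if p: "prime p" for p
  proof
    assume dvd: "p dvd a + t * b \<and> p dvd c"
    show False
    proof (cases "p dvd a")
      case False
      then have "p \<in> P"
        using p dvd assms(1) by (simp add: P_def in_prime_factors_iff)
      then have "p dvd t"
        unfolding t_def using P by (rule dvd_prodI[rotated])
      then show False
        using False dvd dvd_add_left_iff[of p "t * b" a] by simp
    next
      case True
      then have "p dvd t * b"
        using dvd dvd_add_right_iff[of p a "t * b"] by simp
      then have "p dvd t"
        using p True dvd cop prime_dvd_multD by blast
      then obtain r where "r \<in> P" "p dvd r"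
        unfolding t_def using p P prime_dvd_prod_iff[of P p "\<lambda>x. x"] by auto
      then show False
        using p True primes_dvd_imp_eq[of p r] by (auto simp: P_def in_prime_factors_iff)
    qed
  qed
  then have "is_unit (gcd (a + t * b) c)"
    using assms(1) prime_divisor_exists[of "gcd (a + t * b) c"] by fastforce
  then show ?thesis
    by (auto simp: coprime_iff_gcd_eq_1)
qed

lemma bezout_Gcd_int:
  fixes y :: "'a \<Rightarrow> int"
  assumes "finite A"
  shows "\<exists>r. (\<Sum>k\<in>A. r k * y k) = Gcd (y ` A)"
  using assms
proof (induction A)
  case (insert a A)
  then obtain r where r: "(\<Sum>k\<in>A. r k * y k) = Gcd (y ` A)" by blast
  obtain u v where uv: "u * y a + v * Gcd (y ` A) = gcd (y a) (Gcd (y ` A))"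
    using bezout_int by blast
  have "(\<Sum>k\<in>insert a A. (if k = a then u else v * r k) * y k) = u * y a + (\<Sum>k\<in>A. v * r k * y k)"
    using insert by (auto intro!: sum.cong)
  also have "(\<Sum>k\<in>A. v * r k * y k) = v * Gcd (y ` A)"
    by (simp add: r[symmetric] sum_distrib_left mult.assoc)
  finally show ?case
    using uv by (intro exI[of _ "\<lambda>k. if k = a then u else v * r k"]) simp
qed simp

section \<open>Transvections\<close>

declare index_mult_mat(1) [simp del]

text \<open>Vectors of length \<open>n\<close> are functions of which only the values below \<open>n\<close> matter.\<close>

locale special_linear =
  fixes n :: nat
begin

sublocale group "SL_int n"
  by (rule group_SL_int)

definition dot :: "(nat \<Rightarrow> int) \<Rightarrow> (nat \<Rightarrow> int) \<Rightarrow> int" where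
  "dot w v = (\<Sum>i<n. w i * v i)"

text \<open>The matrix I + v w^T. It is a transvection only when \<open>dot w v = 0\<close>, a
  condition that the lemmas carry separately.\<close>

definition tv :: "(nat \<Rightarrow> int) \<Rightarrow> (nat \<Rightarrow> int) \<Rightarrow> int mat" where
  "tv v w = mat n n (\<lambda>(i,j). (if i = j then 1 else 0) + v i * w j)"

definition unit :: "nat \<Rightarrow> nat \<Rightarrow> int" where
  "unit i k = (if k = i then 1 else 0)"

definition el :: "nat \<Rightarrow> nat \<Rightarrow> int \<Rightarrow> int mat" where
  "el i j c = tv (\<lambda>k. c * unit i k) (unit j)"

definition act :: "int mat \<Rightarrow> (nat \<Rightarrow> int) \<Rightarrow> nat \<Rightarrow> int" where
  "act A v i = (\<Sum>k<n. A $$ (i,k) * v k)"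

definition coact :: "int mat \<Rightarrow> (nat \<Rightarrow> int) \<Rightarrow> nat \<Rightarrow> int" where
  "coact A w j = (\<Sum>k<n. w k * A $$ (k,j))"

text \<open>The first \<open>n\<close> entries have gcd 1, in Bezout form, which \<open>act\<close>
  by an invertible matrix visibly preserves.\<close>

definition unimodular :: "(nat \<Rightarrow> int) \<Rightarrow> bool" where
  "unimodular v \<longleftrightarrow> (\<exists>r. dot r v = 1)"

lemma SL_simps [simp]:
  "x \<otimes>\<^bsub>SL_int n\<^esub> y = x * y" "\<one>\<^bsub>SL_int n\<^esub> = 1\<^sub>m n"
  by (simp_all add: SL_int_def)

lemma SL_carrier: "A \<in> carrier (SL_int n) \<longleftrightarrow> A \<in> carrier_mat n n \<and> det A = 1"
  by (simp add: SL_int_def)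

lemma SL_carrier_mat: "A \<in> carrier (SL_int n) \<Longrightarrow> A \<in> carrier_mat n n"
  by (simp add: SL_int_def)

lemma mult_entry:
  assumes "A \<in> carrier_mat n n" "B \<in> carrier_mat n n" "i < n" "j < n"
  shows "(A * B) $$ (i,j) = (\<Sum>k<n. A $$ (i,k) * B $$ (k,j))"
  using assms by (auto simp: index_mult_mat scalar_prod_def lessThan_atLeast0 intro!: sum.cong)

lemma unit_simps [simp]: "unit i i = 1" "i \<noteq> j \<Longrightarrow> unit i j = 0"
  by (auto simp: unit_def)

lemma sum_unit [simp]:
  "i < n \<Longrightarrow> (\<Sum>k<n. f k * unit i k) = f i"
  "i < n \<Longrightarrow> (\<Sum>k<n. unit i k * f k) = f i"
  by (simp_all add: unit_def if_distrib if_distribR cong: if_cong)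

lemma dot_unit [simp]: "i < n \<Longrightarrow> dot (unit i) v = v i" "i < n \<Longrightarrow> dot v (unit i) = v i"
  by (simp_all add: dot_def)

lemma dot_add: "dot (\<lambda>k. w k + w' k) v = dot w v + dot w' v" "dot w (\<lambda>k. v k + v' k) = dot w v + dot w v'"
  by (simp_all add: dot_def algebra_simps sum.distrib)

lemma dot_diff: "dot (\<lambda>k. w k - w' k) v = dot w v - dot w' v" "dot w (\<lambda>k. v k - v' k) = dot w v - dot w v'"
  by (simp_all add: dot_def algebra_simps sum_subtractf)

lemma dot_scale: "dot (\<lambda>k. c * w k) v = c * dot w v" "dot w (\<lambda>k. c * v k) = c * dot w v"
  by (simp_all add: dot_def sum_distrib_left mult_ac)

lemma dot_sum: "dot (\<lambda>k. \<Sum>a\<in>A. w a k) v = (\<Sum>a\<in>A. dot (w a) v)"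
  "dot v (\<lambda>k. \<Sum>a\<in>A. w a k) = (\<Sum>a\<in>A. dot v (w a))"
  unfolding dot_def sum_distrib_right sum_distrib_left by (rule sum.swap)+

lemma dot_zero [simp]: "dot (\<lambda>k. 0) v = 0" "dot v (\<lambda>k. 0) = 0"
  by (simp_all add: dot_def)

lemma dot_cong: "(\<And>k. k < n \<Longrightarrow> w k = w' k) \<Longrightarrow> (\<And>k. k < n \<Longrightarrow> v k = v' k) \<Longrightarrow> dot w v = dot w' v'"
  by (simp add: dot_def)

lemma tv_carrier [simp]: "tv v w \<in> carrier_mat n n"
  by (simp add: tv_def)

lemma tv_dim [simp]: "dim_row (tv v w) = n" "dim_col (tv v w) = n"
  by (simp_all add: tv_def)

lemma tv_entry: "i < n \<Longrightarrow> j < n \<Longrightarrow> tv v w $$ (i,j) = unit i j + v i * w j"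
  by (simp add: tv_def unit_def)

text \<open>Only the outer product matters, so scalar factors can be moved between the vector and
  the covector.\<close>

lemma tv_cong:
  "(\<And>i j. i < n \<Longrightarrow> j < n \<Longrightarrow> v i * w j = v' i * w' j) \<Longrightarrow> tv v w = tv v' w'"
  by (intro eq_matI) (auto simp: tv_entry)

lemma tv_zero: "tv (\<lambda>k. 0) w = 1\<^sub>m n" "tv v (\<lambda>k. 0) = 1\<^sub>m n"
  by (auto simp: tv_entry unit_def)

lemma mat_eqI:
  assumes "A \<in> carrier_mat n n" "B \<in> carrier_mat n n"
    "\<And>i j. i < n \<Longrightarrow> j < n \<Longrightarrow> A $$ (i,j) = B $$ (i,j)"
  shows "A = B"
  using assms by (intro eq_matI) auto

lemma mult_tv_entry:
  assumes "A \<in> carrier_mat n n" "i < n" "j < n"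
  shows "(A * tv v w) $$ (i,j) = A $$ (i,j) + act A v i * w j"
proof -
  have "(A * tv v w) $$ (i,j) = (\<Sum>k<n. A $$ (i,k) * unit k j) + (\<Sum>k<n. A $$ (i,k) * v k * w j)"
    using assms by (simp add: mult_entry[OF _ tv_carrier] tv_entry distrib_left sum.distrib mult.assoc)
  also have "(\<Sum>k<n. A $$ (i,k) * unit k j) = (\<Sum>k<n. A $$ (i,k) * unit j k)"
    by (intro sum.cong) (auto simp: unit_def)
  finally show ?thesis
    using assms by (simp add: act_def sum_distrib_right)
qed

lemma tv_mult_entry:
  assumes "A \<in> carrier_mat n n" "i < n" "j < n"
  shows "(tv v w * A) $$ (i,j) = A $$ (i,j) + v i * coact A w j"
  using assms by (simp add: mult_entry[OF tv_carrier] tv_entry distrib_right sum.distrib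
      coact_def sum_distrib_left mult.assoc)

lemma act_tv: "i < n \<Longrightarrow> act (tv v w) x i = x i + v i * dot w x"
  by (simp add: act_def tv_entry distrib_right sum.distrib dot_def sum_distrib_left mult.assoc)

lemma coact_tv: "j < n \<Longrightarrow> coact (tv v w) x j = x j + dot x v * w j"
proof -
  assume j: "j < n"
  have "(\<Sum>k<n. x k * unit k j) = (\<Sum>k<n. x k * unit j k)"
    by (intro sum.cong) (auto simp: unit_def)
  then show ?thesis
    using j by (simp add: coact_def tv_entry distrib_left sum.distrib dot_def sum_distrib_right mult.assoc)
qed

lemma act_mult:
  assumes "A \<in> carrier_mat n n" "B \<in> carrier_mat n n" "i < n"
  shows "act (A * B) x i = act A (act B x) i"
proof -
  have "act (A * B) x i = (\<Sum>k<n. \<Sum>l<n. A $$ (i,l) * B $$ (l,k) * x k)"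
    using assms by (simp add: act_def mult_entry sum_distrib_right)
  also have "\<dots> = (\<Sum>l<n. \<Sum>k<n. A $$ (i,l) * B $$ (l,k) * x k)"
    by (rule sum.swap)
  finally show ?thesis
    by (simp add: act_def sum_distrib_left mult.assoc)
qed

lemma act_one [simp]: "i < n \<Longrightarrow> act (1\<^sub>m n) x i = x i"
  using act_tv[of i "\<lambda>k. 0" "\<lambda>k. 0"] by (simp add: tv_zero)

lemma act_cong: "(\<And>k. k < n \<Longrightarrow> x k = y k) \<Longrightarrow> act A x i = act A y i"
  by (simp add: act_def)

lemma act_unit: "k < n \<Longrightarrow> act A (unit k) i = A $$ (i,k)"
  by (simp add: act_def)

lemma dot_act: "dot w (act A v) = dot (coact A w) v"
  unfolding dot_def act_def coact_def sum_distrib_left sum_distrib_right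
  by (subst sum.swap) (simp add: mult.assoc)

text \<open>The cross term of the product is \<open>dot w v\<close> times v w'^T and
  vanishes.\<close>

lemma tv_mult_tv_row:
  "dot w v = 0 \<Longrightarrow> tv v w * tv v w' = tv v (\<lambda>k. w k + w' k)"
  by (rule mat_eqI) (auto simp: mult_tv_entry tv_entry act_tv algebra_simps)

lemma tv_mult_tv_col:
  "dot w v' = 0 \<Longrightarrow> tv v w * tv v' w = tv (\<lambda>k. v k + v' k) w"
  by (rule mat_eqI) (auto simp: mult_tv_entry tv_entry act_tv algebra_simps)

text \<open>The Heisenberg relation: I + x y^T is the commutator of I + x e_i^T and I + e_i y^T,
  written without inverses. If \<open>x\<close> and \<open>y\<close> are both divisible by m, the
  result has level m^2.\<close>

lemma tv_commutator:
  assumes "i < n" "dot y x = 0" "x i = 0" "y i = 0"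
  shows "tv x (unit i) * tv (unit i) y = tv x y * (tv (unit i) y * tv x (unit i))"
proof (rule mat_eqI)
  \<comment> \<open>Both factors fix \<open>y\<close> as a row vector, because
    \<open>y i = 0\<close> and \<open>dot y x = 0\<close>. Multiplying by \<open>tv x y\<close> on
    the left therefore just adds x y^T.\<close>
  have c: "coact (tv (unit i) y * tv x (unit i)) y j = y j" if "j < n" for j
  proof -
    have "coact (tv (unit i) y * tv x (unit i)) y j =
      dot y (\<lambda>k. (tv (unit i) y * tv x (unit i)) $$ (k,j))"
      by (simp add: coact_def dot_def)
    also have "\<dots> = dot y (\<lambda>k. unit j k + unit i k * y j + x k * unit i j)"
      using that assms by (intro dot_cong refl) (auto simp: mult_tv_entry tv_entry act_tv unit_def)
    also have "\<dots> = y j"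
      using that assms by (simp add: dot_add dot_scale[where c = "_ j"] mult.commute[of _ "_ j"])
    finally show ?thesis .
  qed
  have P: "tv (unit i) y * tv x (unit i) \<in> carrier_mat n n"
    by (rule mult_carrier_mat[of _ n n]) simp_all
  fix k j assume "k < n" "j < n"
  then show "(tv x (unit i) * tv (unit i) y) $$ (k,j) = (tv x y * (tv (unit i) y * tv x (unit i))) $$ (k,j)"
    using assms c[of j] by (simp add: tv_mult_entry[OF P] mult_tv_entry tv_entry act_tv algebra_simps)
qed (auto intro!: mult_carrier_mat[of _ n n])

text \<open>Both sides equal g + (g v) w^T, since w^T h g = w^T.\<close>

lemma conj_tv:
  assumes "g \<in> carrier_mat n n" "h \<in> carrier_mat n n" "h * g = 1\<^sub>m n"
  shows "g * tv v w = tv (act g v) (coact h w) * g"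
proof (rule mat_eqI)
  fix i j assume ij: "i < n" "j < n"
  have "coact g (coact h w) j = (\<Sum>k<n. \<Sum>l<n. w l * (h $$ (l,k) * g $$ (k,j)))"
    by (simp add: coact_def sum_distrib_right mult.assoc)
  also have "\<dots> = (\<Sum>l<n. \<Sum>k<n. w l * (h $$ (l,k) * g $$ (k,j)))"
    by (rule sum.swap)
  also have "\<dots> = (\<Sum>l<n. w l * (h * g) $$ (l,j))"
    using assms(1,2) ij by (simp add: mult_entry sum_distrib_left)
  also have "\<dots> = (\<Sum>l<n. w l * unit j l)"
    using ij by (intro sum.cong) (auto simp: assms(3) unit_def)
  finally have "coact g (coact h w) j = w j"
    using ij by simp
  then show "(g * tv v w) $$ (i,j) = (tv (act g v) (coact h w) * g) $$ (i,j)"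
    using assms ij by (simp add: mult_tv_entry tv_mult_entry)
qed (use assms in \<open>auto intro!: mult_carrier_mat[of _ n n]\<close>)

lemma el_in_SL:
  assumes "i < n" "j < n" "i \<noteq> j"
  shows "el i j c \<in> carrier (SL_int n)"
proof -
  have "el i j c = addrow_mat n c i j"
    by (rule eq_matI) (auto simp: el_def tv_entry unit_def)
  then show ?thesis
    using det_addrow_mat[OF assms(3), of n c] by (simp add: SL_carrier)
qed

lemma act_el: "i < n \<Longrightarrow> j < n \<Longrightarrow> k < n \<Longrightarrow> act (el i j c) x k = x k + (if k = i then c * x j else 0)"
  by (simp add: el_def act_tv unit_def)

lemma exists_third_index:
  assumes "3 \<le> n"
  shows "\<exists>k<n. k \<noteq> i \<and> k \<noteq> j"
proof -
  have "\<exists>k\<in>{0,1,2::nat}. k \<noteq> i \<and> k \<noteq> j" by auto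
  then obtain k where "k \<in> {0,1,2::nat}" "k \<noteq> i" "k \<noteq> j" by blast
  then show ?thesis using assms by (intro exI[of _ k]) auto
qed

end

section \<open>Assembling transvections inside a subgroup\<close>

locale special_linear_subgroup = special_linear +
  fixes K
  assumes subgroup_K: "subgroup K (SL_int n)"
begin

lemma K_mult: "x \<in> K \<Longrightarrow> y \<in> K \<Longrightarrow> x * y \<in> K"
  using subgroup.m_closed[OF subgroup_K] by simp

lemma K_one: "1\<^sub>m n \<in> K"
  using subgroup.one_closed[OF subgroup_K] by simp

lemma K_inv: "x \<in> K \<Longrightarrow> inv\<^bsub>SL_int n\<^esub> x \<in> K"
  using subgroup.m_inv_closed[OF subgroup_K] by simp

lemma K_carrier: "x \<in> K \<Longrightarrow> x \<in> carrier (SL_int n)"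
  using subgroup.mem_carrier[OF subgroup_K] by simp

lemma K_left_factor:
  assumes "Z \<in> carrier_mat n n" "A \<in> K" "Z * A \<in> K"
  shows "Z \<in> K"
proof -
  define B where "B = inv\<^bsub>SL_int n\<^esub> A"
  have B: "B \<in> K" "A * B = 1\<^sub>m n"
    using K_inv r_inv[OF K_carrier] assms(2) by (simp_all add: B_def)
  then have "Z = Z * (A * B)"
    using assms(1) by simp
  also have "\<dots> = (Z * A) * B"
    by (rule assoc_mult_mat[symmetric, of _ n n _ n _ n])
      (use assms B K_carrier SL_carrier_mat in auto)
  also have "\<dots> \<in> K"
    using assms B K_mult by simp
  finally show ?thesis .
qed

lemma K_tv_row_sum:
  assumes "finite A" "\<And>a. a \<in> A \<Longrightarrow> dot (w a) v = 0" "\<And>a. a \<in> A \<Longrightarrow> tv v (w a) \<in> K"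
  shows "tv v (\<lambda>k. \<Sum>a\<in>A. w a k) \<in> K"
  using assms
proof (induction A)
  case (insert a A)
  then show ?case
    using K_mult[of "tv v (w a)" "tv v (\<lambda>k. \<Sum>a\<in>A. w a k)"] by (simp add: tv_mult_tv_row)
qed (simp add: tv_zero K_one)

lemma K_tv_col_sum:
  assumes "finite A" "\<And>a. a \<in> A \<Longrightarrow> dot w (v a) = 0" "\<And>a. a \<in> A \<Longrightarrow> tv (v a) w \<in> K"
  shows "tv (\<lambda>k. \<Sum>a\<in>A. v a k) w \<in> K"
  using assms
proof (induction A)
  case (insert a A)
  have "dot w (\<lambda>k. \<Sum>a\<in>A. v a k) = 0"
    using insert by (simp add: dot_sum)
  then show ?case
    using insert K_mult[of "tv (v a) w" "tv (\<lambda>k. \<Sum>a\<in>A. v a k) w"] by (simp add: tv_mult_tv_col)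
qed (simp add: tv_zero K_one)

text \<open>The Koszul relations \<open>v j * unit i - v i * unit j\<close> span the orthogonal complement of a
  unimodular \<open>v\<close>, so it suffices to treat transvections along them. The part of \<open>v\<close> supported on
  \<open>{i, j}\<close> is handled by a commutator through a third coordinate.\<close>

lemma tv_in_subgroup_if_el_in_subgroup:
  assumes n: "3 \<le> n" and el: "\<And>i j z. i < n \<Longrightarrow> j < n \<Longrightarrow> i \<noteq> j \<Longrightarrow> el i j (m * z) \<in> K"
    and v: "unimodular v" and w: "dot w v = 0"
  shows "tv v (\<lambda>k. m\<^sup>2 * w k) \<in> K"
proof -
  define a where "a i j k = v j * unit i k - v i * unit j k" for i j k
  have av: "dot (a i j) v = 0" if "i < n" "j < n" for i j
    using that by (simp add: a_def[abs_def] dot_diff dot_scale)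
  have elementary: "tv (\<lambda>k. b * unit i k) (\<lambda>k. c * unit j k) \<in> K"
    if "i < n" "j < n" "i \<noteq> j" "m dvd b * c" for i j b c
  proof -
    obtain z where "b * c = m * z" using \<open>m dvd b * c\<close> by (auto simp: dvd_def)
    then have "tv (\<lambda>k. b * unit i k) (\<lambda>k. c * unit j k) = el i j (m * z)"
      unfolding el_def by (intro tv_cong) (simp add: algebra_simps)
    then show ?thesis using el that by simp
  qed
  \<comment> \<open>The covector \<open>a i j\<close> is supported on \<open>{i,j}\<close> and
    \<open>l\<close> lies outside, so this is a product of two elementary matrices in row
    \<open>l\<close>.\<close>
  have row: "tv (\<lambda>k. b * unit l k) (\<lambda>k. m * c * a i j k) \<in> K"
    if "i < n" "j < n" "l < n" "i \<noteq> j" "l \<noteq> i" "l \<noteq> j" for i j l b c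
  proof -
    have *: "tv (\<lambda>k. b * unit l k) (\<lambda>k. \<Sum>s\<in>{i,j}. (m * c * (if s = i then v j else - v i)) * unit s k) \<in> K"
      using that by (intro K_tv_row_sum elementary) (auto simp: dot_scale)
    have "(\<lambda>k. \<Sum>s\<in>{i,j}. (m * c * (if s = i then v j else - v i)) * unit s k) = (\<lambda>k. m * c * a i j k)"
      using that by (auto simp: a_def algebra_simps fun_eq_iff)
    with * show ?thesis by simp
  qed
  have col: "tv (\<lambda>k. m * (v i * unit i k + v j * unit j k)) (unit l) \<in> K"
    if "i < n" "j < n" "l < n" "i \<noteq> j" "l \<noteq> i" "l \<noteq> j" for i j l
  proof -
    have *: "tv (\<lambda>k. \<Sum>s\<in>{i,j}. (m * v s) * unit s k) (\<lambda>k. 1 * unit l k) \<in> K"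
      using that by (intro K_tv_col_sum elementary) (auto simp: dot_scale)
    have "(\<lambda>k. \<Sum>s\<in>{i,j}. (m * v s) * unit s k) = (\<lambda>k. m * (v i * unit i k + v j * unit j k))"
      using that by (auto simp: algebra_simps fun_eq_iff)
    with * show ?thesis by simp
  qed
  have koszul: "tv v (\<lambda>k. m\<^sup>2 * c * a i j k) \<in> K" if ij: "i < n" "j < n" for i j c
  proof (cases "i = j")
    case True
    then show ?thesis by (simp add: a_def tv_zero K_one)
  next
    case False
    define x where "x k = v i * unit i k + v j * unit j k" for k
    obtain l where l: "l < n" "l \<noteq> i" "l \<noteq> j"
      using exists_third_index[OF n] by blast
    \<comment> \<open>Each factor gets one \<open>m\<close>; their commutator \<open>Z\<close> has
      level \<open>m\<^sup>2\<close>, the source of the square in the conclusion.\<close>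
    define X Y where "X = tv (\<lambda>k. m * x k) (unit l)" and "Y = tv (unit l) (\<lambda>k. m * c * a i j k)"
    define Z where "Z = tv (\<lambda>k. m * x k) (\<lambda>k. m * c * a i j k)"
    have XY: "X \<in> K" "Y \<in> K"
      using col[OF ij l(1) False l(2,3)] row[OF ij l(1) False l(2,3), of 1 c] by (simp_all add: X_def Y_def x_def)
    have ax: "dot (a i j) x = 0"
      using ij False by (simp add: a_def[abs_def] x_def[abs_def] dot_diff dot_scale dot_add)
    have "X * Y = Z * (Y * X)"
      unfolding X_def Y_def Z_def
    proof (intro tv_commutator l)
      show "dot (\<lambda>k. m * c * a i j k) (\<lambda>k. m * x k) = 0"
        using ax by (simp add: dot_scale)
    qed (use l in \<open>simp_all add: x_def a_def\<close>)
    moreover have "X * Y \<in> K" "Y * X \<in> K"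
      using XY K_mult by auto
    moreover have Zc: "Z \<in> carrier_mat n n"
      by (simp add: Z_def)
    ultimately have Z: "Z \<in> K"
      using K_left_factor by metis
    have "Z = tv x (\<lambda>k. m\<^sup>2 * c * a i j k)"
      unfolding Z_def by (intro tv_cong) (simp add: power2_eq_square algebra_simps)
    with Z have x: "tv x (\<lambda>k. m\<^sup>2 * c * a i j k) \<in> K" by simp
    \<comment> \<open>The label \<open>n\<close>, which is not a coordinate, stands for the part
      \<open>x\<close> of \<open>v\<close>; the other labels are the single coordinates outside
      \<open>{i,j}\<close>, reached by \<open>row\<close>.\<close>
    define y where "y s = (if s = n then x else (\<lambda>k. v s * unit s k))" for s
    define A where "A = insert n ({..<n} - {i,j})"
    have "tv (\<lambda>k. \<Sum>s\<in>A. y s k) (\<lambda>k. m\<^sup>2 * c * a i j k) \<in> K"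
    proof (rule K_tv_col_sum)
      fix s assume "s \<in> A"
      then consider "s = n" | "s < n" "s \<noteq> i" "s \<noteq> j"
        by (auto simp: A_def)
      then have "dot (\<lambda>k. m\<^sup>2 * c * a i j k) (y s) = 0 \<and> tv (y s) (\<lambda>k. m\<^sup>2 * c * a i j k) \<in> K"
      proof cases
        case 1
        then show ?thesis using x ax by (simp add: y_def dot_scale)
      next
        case 2
        then show ?thesis using row[OF ij 2(1) False 2(2,3), of "v s" "m * c"]
          by (simp add: y_def dot_scale power2_eq_square mult.assoc) (simp add: a_def unit_def)
      qed
      then show "dot (\<lambda>k. m\<^sup>2 * c * a i j k) (y s) = 0" "tv (y s) (\<lambda>k. m\<^sup>2 * c * a i j k) \<in> K" by auto
    qed (auto simp: A_def)
    moreover have "(\<Sum>s\<in>A. y s k) = v k" if "k < n" for k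
    proof -
      have "(\<Sum>s\<in>A. y s k) = x k + (\<Sum>s\<in>{..<n} - {i,j}. v s * unit k s)"
        unfolding A_def by (subst sum.insert) (auto simp: y_def unit_def intro!: sum.cong split: if_splits)
      also have "(\<Sum>s\<in>{..<n} - {i,j}. v s * unit k s) = (if k = i \<or> k = j then 0 else v k)"
        using that by (simp add: unit_def if_distrib cong: if_cong)
      finally show ?thesis using False by (auto simp: x_def unit_def)
    qed
    ultimately show ?thesis
      using tv_cong[of "\<lambda>k. \<Sum>s\<in>A. y s k" "\<lambda>k. m\<^sup>2 * c * a i j k" v "\<lambda>k. m\<^sup>2 * c * a i j k"] by simp
  qed
  obtain r where r: "dot r v = 1"
    using v by (auto simp: unimodular_def)
  \<comment> \<open>The sum over all i, j of r_j w_i (v_j e_i - v_i e_j) is (r . v) w - (w . v) r,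
    which equals \<open>w\<close> here.\<close>
  define b where "b p k = m\<^sup>2 * (r (snd p) * w (fst p)) * a (fst p) (snd p) k" for p k
  have "tv v (\<lambda>k. \<Sum>p\<in>{..<n} \<times> {..<n}. b p k) \<in> K"
    using av koszul unfolding b_def by (intro K_tv_row_sum) (auto simp: dot_scale)
  moreover have "(\<Sum>p\<in>{..<n} \<times> {..<n}. b p k) = m\<^sup>2 * w k" if k: "k < n" for k
  proof -
    have "(\<Sum>p\<in>{..<n} \<times> {..<n}. b p k) = (\<Sum>i<n. \<Sum>j<n. m\<^sup>2 * (r j * w i) * (v j * unit i k - v i * unit j k))"
      unfolding b_def a_def by (simp add: sum.cartesian_product case_prod_unfold)
    also have "\<dots> = (\<Sum>i<n. \<Sum>j<n. (m\<^sup>2 * w i * unit k i) * (r j * v j)) -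
       (\<Sum>i<n. \<Sum>j<n. (m\<^sup>2 * w i * v i) * (r j * unit k j))"
      unfolding sum_subtractf[symmetric] by (intro sum.cong refl) (auto simp: unit_def algebra_simps)
    also have "\<dots> = m\<^sup>2 * w k * dot r v - m\<^sup>2 * dot w v * r k"
    proof -
      have "(\<Sum>i<n. m\<^sup>2 * w i * v i) = m\<^sup>2 * dot w v"
        by (simp add: dot_def sum_distrib_left mult.assoc)
      then show ?thesis
        using k unfolding sum_product[symmetric] by (simp add: dot_def[symmetric])
    qed
    finally show ?thesis using r w by simp
  qed
  ultimately show ?thesis
    using tv_cong[of v "\<lambda>k. \<Sum>p\<in>{..<n} \<times> {..<n}. b p k" v "\<lambda>k. m\<^sup>2 * w k"] by auto
qed

end

section \<open>Generation by elementary matrices\<close>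

locale special_linear_elementary = special_linear_subgroup +
  assumes el_in_K: "i < n \<Longrightarrow> j < n \<Longrightarrow> i \<noteq> j \<Longrightarrow> el i j c \<in> K"
begin

text \<open>The stabiliser in \<open>K\<close> of the first \<open>r\<close> basis vectors: its
  elements preserve the columns that are already cleared.\<close>

definition fixing :: "nat \<Rightarrow> int mat set" where
  "fixing r = {g \<in> K. \<forall>i<r. \<forall>k<n. act g (unit i) k = unit i k}"

definition reducible :: "nat \<Rightarrow> (nat \<Rightarrow> int) \<Rightarrow> bool" where
  "reducible r x \<longleftrightarrow> (\<exists>g\<in>fixing r. \<forall>k<n. act g x k = unit r k)"

text \<open>Entries before \<open>r\<close> are ignored: once entry \<open>r\<close> is 1, multiples
  of it clear them.\<close>

definition primitive_from :: "nat \<Rightarrow> (nat \<Rightarrow> int) \<Rightarrow> bool" where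
  "primitive_from r x \<longleftrightarrow> (\<forall>d. (\<forall>k\<in>{r..<n}. d dvd x k) \<longrightarrow> is_unit d)"

lemma fixing_mult:
  assumes "g \<in> fixing r" "h \<in> fixing r"
  shows "g * h \<in> fixing r"
proof -
  have "g \<in> carrier_mat n n" "h \<in> carrier_mat n n"
    using assms K_carrier SL_carrier_mat by (auto simp: fixing_def)
  moreover have "act g (act h (unit i)) k = unit i k" if "i < r" "k < n" for i k
    using assms that act_cong[of "act h (unit i)" "unit i" g k] by (simp add: fixing_def)
  ultimately show ?thesis
    using assms K_mult by (auto simp: fixing_def act_mult)
qed

lemma reducible_unit:
  assumes "\<And>k. k < n \<Longrightarrow> x k = unit r k"
  shows "reducible r x"
  unfolding reducible_def using assms K_one by (intro bexI[of _ "1\<^sub>m n"]) (auto simp: fixing_def)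

text \<open>An elementary matrix moves only basis vector \<open>j\<close>, so
  \<open>r \<le> j\<close> suffices to fix the first \<open>r\<close> of them; the target row
  \<open>i\<close> is free.\<close>

lemma reducible_step:
  assumes "reducible r (x(i := x i + c * x j))" "i < n" "j < n" "r \<le> j" "i \<noteq> j"
  shows "reducible r x"
proof -
  obtain g where g: "g \<in> fixing r" "\<And>k. k < n \<Longrightarrow> act g (x(i := x i + c * x j)) k = unit r k"
    using assms(1) by (auto simp: reducible_def)
  have e: "el i j c \<in> fixing r"
    using assms el_in_K by (auto simp: fixing_def act_el)
  have "act (g * el i j c) x k = unit r k" if "k < n" for k
  proof -
    have "act (g * el i j c) x k = act g (act (el i j c) x) k"
      using g(1) e that K_carrier SL_carrier_mat by (intro act_mult) (auto simp: fixing_def)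
    also have "\<dots> = act g (x(i := x i + c * x j)) k"
      using assms by (intro act_cong) (simp add: act_el)
    finally show ?thesis using g(2) that by simp
  qed
  then show ?thesis
    unfolding reducible_def using fixing_mult[OF g(1) e] by blast
qed

lemma reducible_if_tail_unit:
  assumes "r < n" "\<And>k. k \<in> {r..<n} \<Longrightarrow> x k = unit r k"
  shows "reducible r x"
proof -
  have "reducible r x" if "finite A" "A \<subseteq> {..<r}" "\<And>k. k < n \<Longrightarrow> k \<notin> A \<Longrightarrow> x k = unit r k" for A x
    using that
  proof (induction A arbitrary: x)
    case empty
    then show ?case by (auto intro: reducible_unit)
  next
    case (insert a A)
    have "x r = 1"
      using insert.prems(2)[of r] insert.prems(1) assms(1) by auto
    then have "reducible r (x(a := x a + (- x a) * x r))"
      using insert.prems by (intro insert.IH) (auto simp: unit_def)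
    then show ?case
      using insert.prems assms(1) by (intro reducible_step[of r x a "- x a" r]) auto
  qed
  from this[of "{..<r}" x] show ?thesis
    using assms by auto
qed

text \<open>An entry -1 cannot be rescaled in determinant 1; a second coordinate repairs the sign.
  If \<open>p\<close> is beyond \<open>r\<close>, adding \<open>x p\<close> times entry
  \<open>p\<close> puts its square, 1, at position \<open>r\<close>.\<close>

lemma reducible_if_single:
  assumes r: "Suc r < n" and p: "p \<in> {r..<n}" "is_unit (x p)"
    and zero: "\<And>k. k \<in> {r..<n} \<Longrightarrow> k \<noteq> p \<Longrightarrow> x k = 0"
  shows "reducible r x"
proof -
  have other: "reducible r x" if "p \<in> {Suc r..<n}" "is_unit (x p)"
    "\<And>k. k \<in> {r..<n} \<Longrightarrow> k \<noteq> p \<Longrightarrow> x k = 0" for x p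
  proof -
    have sq: "x p * x p = 1"
      using that(2) by (auto simp: zdvd1_eq abs_if split: if_splits)
    define y where "y = x(r := x r + x p * x p)"
    define z where "z = y(p := y p + (- x p) * y r)"
    have "reducible r z"
    proof (rule reducible_if_tail_unit)
      show "r < n" using r by simp
      fix k assume "k \<in> {r..<n}"
      then show "z k = unit r k"
        using that(1) that(3)[of k] that(3)[of r] sq by (auto simp: y_def z_def unit_def)
    qed
    then have "reducible r y"
      unfolding z_def using that(1) r by (intro reducible_step[of r y p "- x p" r]) auto
    then show ?thesis
      unfolding y_def using that(1) r by (intro reducible_step[of r x r "x p" p]) auto
  qed
  show ?thesis
  proof (cases "p = r")
    case False
    then show ?thesis using p zero by (intro other[of p]) auto
  next
    case True
    \<comment> \<open>Copies the entry to \<open>Suc r\<close> and erases it at \<open>r\<close>,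
      which returns to the previous case.\<close>
    define y where "y = x(Suc r := x (Suc r) + 1 * x r)"
    define z where "z = y(r := y r + (-1) * y (Suc r))"
    have "reducible r z"
    proof (rule other[of "Suc r"])
      show "is_unit (z (Suc r))"
        using True p r zero[of "Suc r"] by (simp add: z_def y_def)
      fix k assume "k \<in> {r..<n}" "k \<noteq> Suc r"
      then show "z k = 0"
        using True r zero[of k] zero[of "Suc r"] by (auto simp: z_def y_def)
    qed (use r in auto)
    then have "reducible r y"
      unfolding z_def using r by (intro reducible_step[of r y r "-1" "Suc r"]) auto
    then show ?thesis
      unfolding y_def using r by (intro reducible_step[of r x "Suc r" 1 r]) auto
  qed
qed

text \<open>Subtractive Euclid on the sum of absolute values. When no entry can be shortened by
  another, one nonzero entry is left, and primitivity makes it a unit.\<close>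

lemma reducible_if_primitive_from:
  assumes "Suc r < n" "primitive_from r x"
  shows "reducible r x"
  using assms(2)
proof (induction "\<Sum>k\<in>{r..<n}. nat \<bar>x k\<bar>" arbitrary: x rule: less_induct)
  case less
  show ?case
  proof (cases "\<exists>i\<in>{r..<n}. \<exists>j\<in>{r..<n}. i \<noteq> j \<and> x j \<noteq> 0 \<and> \<bar>x j\<bar> \<le> \<bar>x i\<bar>")
    case True
    then obtain i j where ij: "i \<in> {r..<n}" "j \<in> {r..<n}" "i \<noteq> j" "x j \<noteq> 0" "\<bar>x j\<bar> \<le> \<bar>x i\<bar>"
      by blast
    \<comment> \<open>This sign turns the absolute value of entry \<open>i\<close> into the
      difference of the two absolute values.\<close>
    define c where "c = - (sgn (x i) * sgn (x j))"
    define y where "y = x(i := x i + c * x j)"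
    have small: "\<bar>x i + c * x j\<bar> < \<bar>x i\<bar>"
      using ij(4,5) by (auto simp: c_def sgn_if abs_if split: if_splits)
    have "(\<Sum>k\<in>{r..<n}. nat \<bar>y k\<bar>) < (\<Sum>k\<in>{r..<n}. nat \<bar>x k\<bar>)"
      using ij small by (intro sum_strict_mono_ex1) (auto simp: y_def)
    moreover have "primitive_from r y"
      unfolding primitive_from_def
    proof (intro allI impI)
      fix d assume d: "\<forall>k\<in>{r..<n}. d dvd y k"
      have dj: "d dvd x j"
        using d ij by (auto simp: y_def dest!: bspec[of _ _ j])
      have "d dvd x i + c * x j"
        using d ij by (auto simp: y_def dest!: bspec[of _ _ i])
      then have "d dvd x i"
        using dj by (simp add: dvd_add_left_iff)
      then have "d dvd x k" if "k \<in> {r..<n}" for k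
        using bspec[OF d that] that by (cases "k = i") (auto simp: y_def)
      then show "is_unit d"
        using less.prems by (auto simp: primitive_from_def)
    qed
    ultimately have "reducible r y"
      using less.hyps by blast
    then show ?thesis
      unfolding y_def using ij by (intro reducible_step[of r x i c j]) auto
  next
    case False
    then have incomparable: "\<not> \<bar>x j\<bar> \<le> \<bar>x i\<bar>"
      if "i \<in> {r..<n}" "j \<in> {r..<n}" "i \<noteq> j" "x j \<noteq> 0" for i j
      using that by (meson bexI)
    have "\<exists>p\<in>{r..<n}. x p \<noteq> 0"
    proof (rule ccontr)
      assume "\<not> ?thesis"
      then have "is_unit (0::int)"
        using less.prems unfolding primitive_from_def by auto
      then show False by simp
    qed
    then obtain p where p: "p \<in> {r..<n}" "x p \<noteq> 0" by blast
    have zero: "x k = 0" if "k \<in> {r..<n}" "k \<noteq> p" for k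
    proof (rule ccontr)
      assume "x k \<noteq> 0"
      then have "\<not> \<bar>x k\<bar> \<le> \<bar>x p\<bar>" "\<not> \<bar>x p\<bar> \<le> \<bar>x k\<bar>"
        using incomparable[OF p(1) that(1)] incomparable[OF that(1) p(1)] that p(2) by auto
      then show False by linarith
    qed
    have "\<forall>k\<in>{r..<n}. x p dvd x k"
    proof
      fix k assume "k \<in> {r..<n}"
      then show "x p dvd x k"
        using zero[of k] by (cases "k = p") auto
    qed
    then have "is_unit (x p)"
      using less.prems unfolding primitive_from_def by blast
    then show ?thesis
      using reducible_if_single[OF assms(1) p(1)] zero by blast
  qed
qed

lemma reduce_columns:
  assumes g: "g \<in> carrier (SL_int n)" and "r \<le> n"
  shows "\<exists>h\<in>K. \<forall>i<r. \<forall>k<n. act (h * g) (unit i) k = unit i k"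
  using assms(2)
proof (induction r)
  case 0
  then show ?case using K_one by auto
next
  case (Suc r)
  then obtain h where h: "h \<in> K" "\<And>i k. i < r \<Longrightarrow> k < n \<Longrightarrow> act (h * g) (unit i) k = unit i k"
    by auto
  define f where "f = h * g"
  have f: "f \<in> carrier (SL_int n)"
    using m_closed[OF K_carrier[OF h(1)] g] by (simp add: f_def)
  have fixed: "act f (unit i) k = unit i k" if "i < r" "k < n" for i k
    using h that by (simp add: f_def)
  define x where "x = act f (unit r)"
  have r: "r < n" using Suc.prems by simp
  have "reducible r x"
  proof (cases "Suc r = n")
    case True
    \<comment> \<open>The last column has no further coordinate for sign repairs; instead
      \<open>f\<close> is upper triangular, and determinant 1 forces its last diagonal entry to be
      1.\<close>
    have "f $$ (k,i) = unit i k" if "i < r" "k < n" for i k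
      using fixed[OF that] that r by (simp add: act_unit)
    then have "f $$ (i,j) = 0" if "i < n" "j < i" for i j
      using that True by simp
    then have tri: "upper_triangular f"
      using carrier_matD(1)[OF SL_carrier_mat[OF f]] by (auto simp: upper_triangular_def)
    have "1 = prod_list (diag_mat f)"
      using det_upper_triangular[OF tri SL_carrier_mat[OF f]] f by (simp add: SL_carrier)
    also have "\<dots> = (\<Prod>i<n. f $$ (i,i))"
      using SL_carrier_mat[OF f] by (simp add: prod_list_diag_prod lessThan_atLeast0)
    also have "\<dots> = f $$ (r,r) * (\<Prod>i<r. f $$ (i,i))"
      using True by (simp flip: True add: mult.commute)
    also have "(\<Prod>i<r. f $$ (i,i)) = 1"
      using \<open>\<And>k i. i < r \<Longrightarrow> k < n \<Longrightarrow> f $$ (k,i) = unit i k\<close> r by (intro prod.neutral) auto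
    finally have "x r = 1"
      using r by (simp add: x_def act_unit)
    then show ?thesis
      using True r by (intro reducible_if_tail_unit) (auto simp: less_Suc_eq)
  next
    case False
    have "primitive_from r x"
      unfolding primitive_from_def
    proof (intro allI impI)
      fix d assume d: "\<forall>k\<in>{r..<n}. d dvd x k"
      define f' where "f' = inv\<^bsub>SL_int n\<^esub> f"
      have f': "f' \<in> carrier_mat n n" "f' * f = 1\<^sub>m n"
        using f l_inv[OF f] inv_closed[OF f] SL_carrier_mat by (auto simp: f'_def)
      have undo: "act f' (act f y) r = y r" for y
        using act_mult[OF f'(1) SL_carrier_mat[OF f] r, of y] f'(2) r by simp
      have "f' $$ (r,k) = 0" if "k < r" for k
      proof -
        have "f' $$ (r,k) = act f' (unit k) r"
          using that r by (simp add: act_unit)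
        also have "\<dots> = act f' (act f (unit k)) r"
          using fixed that by (intro act_cong) simp
        finally show ?thesis using undo that by simp
      qed
      then have "d dvd f' $$ (r,k) * x k" if "k < n" for k
        using d that by (cases "k < r") auto
      then have "d dvd act f' x r"
        unfolding act_def by (intro dvd_sum) auto
      then show "is_unit d"
        using undo[of "unit r"] by (simp add: x_def)
    qed
    then show ?thesis
      using False r by (intro reducible_if_primitive_from) auto
  qed
  then obtain l where l: "l \<in> fixing r" "\<And>k. k < n \<Longrightarrow> act l x k = unit r k"
    by (auto simp: reducible_def)
  have lK: "l \<in> K" using l(1) by (simp add: fixing_def)
  have "act ((l * h) * g) (unit i) k = unit i k" if "i < Suc r" "k < n" for i k
  proof -
    have "(l * h) * g = l * f"
      unfolding f_def using lK h(1) g K_carrier SL_carrier_mat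
      by (intro assoc_mult_mat[of _ n n _ n _ n]) auto
    then have "act ((l * h) * g) (unit i) k = act l (act f (unit i)) k"
      using act_mult[OF _ _ that(2)] lK f K_carrier SL_carrier_mat by simp
    also have "\<dots> = unit i k"
    proof (cases "i = r")
      case False
      then have "act l (act f (unit i)) k = act l (unit i) k"
        using fixed that by (intro act_cong) auto
      then show ?thesis
        using l(1) that False by (auto simp: fixing_def)
    qed (use l(2) that in \<open>simp add: x_def\<close>)
    finally show ?thesis .
  qed
  then show ?case
    using K_mult[OF lK h(1)] by blast
qed

lemma K_eq_carrier: "K = carrier (SL_int n)"
proof
  show "K \<subseteq> carrier (SL_int n)" using K_carrier by blast
  show "carrier (SL_int n) \<subseteq> K"
  proof
    fix g assume g: "g \<in> carrier (SL_int n)"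
    obtain h where h: "h \<in> K" "\<And>i k. i < n \<Longrightarrow> k < n \<Longrightarrow> act (h * g) (unit i) k = unit i k"
      using reduce_columns[OF g order_refl] by blast
    have "h * g = 1\<^sub>m n"
    proof (rule mat_eqI)
      show "(h * g) $$ (k,i) = 1\<^sub>m n $$ (k,i)" if "k < n" "i < n" for k i
        using h(2)[of i k] that by (simp add: act_unit unit_def)
      show "h * g \<in> carrier_mat n n"
        using h(1) g K_carrier SL_carrier_mat by (intro mult_carrier_mat) auto
    qed simp
    then have "inv\<^bsub>SL_int n\<^esub> g = h"
      using inv_equality[of h g] h(1) g K_carrier by simp
    then show "g \<in> K"
      using K_inv[OF h(1)] inv_inv[OF g] by simp
  qed
qed

end

context special_linear
begin

lemma subgroup_eq_carrier_if_el:
  assumes "subgroup K (SL_int n)" "\<And>i j c. i < n \<Longrightarrow> j < n \<Longrightarrow> i \<noteq> j \<Longrightarrow> el i j c \<in> K"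
  shows "K = carrier (SL_int n)"
proof -
  interpret special_linear_elementary n K
    by (intro special_linear_elementary.intro special_linear_subgroup.intro
        special_linear_elementary_axioms.intro assms)
  show ?thesis by (rule K_eq_carrier)
qed

lemma transitive_on_unimodular:
  assumes "2 \<le> n" "unimodular v"
  shows "\<exists>g\<in>carrier (SL_int n). \<forall>k<n. act g v k = unit 0 k"
proof -
  interpret special_linear_elementary n "carrier (SL_int n)"
    by (intro special_linear_elementary.intro special_linear_subgroup.intro
        special_linear_elementary_axioms.intro subgroup_self el_in_SL)
  obtain r where "dot r v = 1"
    using assms(2) by (auto simp: unimodular_def)
  have "primitive_from 0 v"
    unfolding primitive_from_def
  proof (intro allI impI)
    fix d assume "\<forall>k\<in>{0..<n}. d dvd v k"
    then have "d dvd dot r v"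
      unfolding dot_def by (intro dvd_sum dvd_mult) auto
    then show "is_unit d"
      using \<open>dot r v = 1\<close> by simp
  qed
  then show ?thesis
    using reducible_if_primitive_from[of 0 v] assms(1) by (auto simp: reducible_def fixing_def)
qed

end

section \<open>Congruence subgroups have finite index\<close>

lemma (in special_linear) unimodular_unit: "i < n \<Longrightarrow> unimodular (unit i)"
  unfolding unimodular_def by (intro exI[of _ "unit i"]) simp

locale special_linear_ge3 = special_linear +
  assumes n3: "3 \<le> n"
begin

text \<open>Ranging over all unimodular directions makes the set invariant under conjugation by the
  whole group.\<close>

definition trans :: "int \<Rightarrow> int mat set" where
  "trans q = {tv v (\<lambda>k. q * w k) | v w. unimodular v \<and> dot w v = 0}"

text \<open>All its elements are congruent to the identity modulo \<open>q\<close>. It is the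
  \<open>N\<close> of the overview.\<close>

definition cong_sub :: "int \<Rightarrow> int mat set" where
  "cong_sub q = generate (SL_int n) (trans q)"

text \<open>The assembly from elementary matrices with level 1 and the whole group as subgroup
  replaces a determinant computation.\<close>

lemma tv_in_SL:
  assumes "unimodular v" "dot w v = 0"
  shows "tv v w \<in> carrier (SL_int n)"
proof -
  interpret special_linear_subgroup n "carrier (SL_int n)"
    by (intro special_linear_subgroup.intro subgroup_self)
  show ?thesis
    using tv_in_subgroup_if_el_in_subgroup[OF n3, of 1 v w] assms el_in_SL by simp
qed

lemma transI: "unimodular v \<Longrightarrow> dot w v = 0 \<Longrightarrow> tv v (\<lambda>k. q * w k) \<in> trans q"
  by (auto simp: trans_def)

lemma trans_closed: "trans q \<subseteq> carrier (SL_int n)"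
  using tv_in_SL by (auto simp: trans_def dot_scale)

lemma inv_tv:
  assumes "unimodular v" "dot w v = 0"
  shows "inv\<^bsub>SL_int n\<^esub> (tv v w) = tv v (\<lambda>k. - w k)"
proof (rule inv_equality)
  have neg: "dot (\<lambda>k. - w k) v = 0"
    using dot_scale(1)[of "-1" w v] assms(2) by simp
  show "tv v w \<in> carrier (SL_int n)" "tv v (\<lambda>k. - w k) \<in> carrier (SL_int n)"
    using tv_in_SL neg assms by auto
  show "tv v (\<lambda>k. - w k) \<otimes>\<^bsub>SL_int n\<^esub> tv v w = \<one>\<^bsub>SL_int n\<^esub>"
    using tv_mult_tv_row[OF neg, of w] by (simp add: tv_zero)
qed

lemma trans_inv:
  assumes "t \<in> trans q"
  shows "inv\<^bsub>SL_int n\<^esub> t \<in> trans q"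
proof -
  obtain v w where t: "t = tv v (\<lambda>k. q * w k)" "unimodular v" "dot w v = 0"
    using assms by (auto simp: trans_def)
  have "inv\<^bsub>SL_int n\<^esub> t = tv v (\<lambda>k. q * (- 1 * w k))"
    using inv_tv[of v "\<lambda>k. q * w k"] t by (simp add: dot_scale)
  also have "\<dots> \<in> trans q"
    using t dot_scale(1)[of "-1" w v] by (intro transI) auto
  finally show ?thesis .
qed

lemma conj_tv_SL:
  assumes g: "g \<in> carrier (SL_int n)"
  shows "g * tv v w * inv\<^bsub>SL_int n\<^esub> g = tv (act g v) (coact (inv\<^bsub>SL_int n\<^esub> g) w)"
    and "dot (coact (inv\<^bsub>SL_int n\<^esub> g) w) (act g v) = dot w v"
    and "unimodular v \<Longrightarrow> unimodular (act g v)"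
proof -
  define h where "h = inv\<^bsub>SL_int n\<^esub> g"
  have hg: "h * g = 1\<^sub>m n" "g * h = 1\<^sub>m n" and c: "g \<in> carrier_mat n n" "h \<in> carrier_mat n n"
    using l_inv[OF g] r_inv[OF g] g inv_closed[OF g] SL_carrier_mat by (auto simp: h_def)
  have "g * tv v w * h = tv (act g v) (coact h w) * g * h"
    using conj_tv[OF c hg(1)] by simp
  also have "\<dots> = tv (act g v) (coact h w) * (g * h)"
    using c by (intro assoc_mult_mat[of _ n n _ n _ n]) auto
  finally show "g * tv v w * inv\<^bsub>SL_int n\<^esub> g = tv (act g v) (coact (inv\<^bsub>SL_int n\<^esub> g) w)"
    unfolding h_def[symmetric] by (simp add: hg)
  have undo: "dot (coact h w) (act g v) = dot w v" for w
  proof -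
    have "dot (coact h w) (act g v) = dot w (act h (act g v))"
      by (rule dot_act[symmetric])
    also have "\<dots> = dot w v"
      by (intro dot_cong refl) (simp add: act_mult[OF c(2,1), symmetric] hg(1))
    finally show ?thesis .
  qed
  show "dot (coact (inv\<^bsub>SL_int n\<^esub> g) w) (act g v) = dot w v"
    using undo by (simp add: h_def)
  show "unimodular (act g v)" if "unimodular v"
    using that undo unfolding unimodular_def by metis
qed

lemma trans_conj:
  assumes "g \<in> carrier (SL_int n)" "t \<in> trans q"
  shows "g \<otimes>\<^bsub>SL_int n\<^esub> t \<otimes>\<^bsub>SL_int n\<^esub> inv\<^bsub>SL_int n\<^esub> g \<in> trans q"
proof -
  obtain v w where t: "t = tv v (\<lambda>k. q * w k)" "unimodular v" "dot w v = 0"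
    using assms by (auto simp: trans_def)
  have "coact A (\<lambda>k. q * w k) = (\<lambda>k. q * coact A w k)" for A
    by (auto simp: coact_def sum_distrib_left mult.assoc)
  then have "g * t * inv\<^bsub>SL_int n\<^esub> g = tv (act g v) (\<lambda>k. q * coact (inv\<^bsub>SL_int n\<^esub> g) w k)"
    using conj_tv_SL(1)[OF assms(1), of v "\<lambda>k. q * w k"] t by simp
  also have "\<dots> \<in> trans q"
    using conj_tv_SL(2,3)[OF assms(1)] t by (intro transI) auto
  finally show ?thesis by simp
qed

lemma cong_sub_normal: "cong_sub q \<lhd> SL_int n"
  unfolding cong_sub_def by (rule normal_generateI[OF trans_closed trans_conj])

lemma generate_trans_one: "generate (SL_int n) (trans 1) = carrier (SL_int n)"
proof (rule subgroup_eq_carrier_if_el)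
  show "subgroup (generate (SL_int n) (trans 1)) (SL_int n)"
    by (rule generate_is_subgroup[OF trans_closed])
  fix i j c assume "i < n" "j < n" "i \<noteq> j"
  then have "tv (unit i) (\<lambda>k. 1 * (c * unit j k)) \<in> trans 1"
    by (intro transI unimodular_unit) (simp_all add: dot_scale)
  moreover have "tv (unit i) (\<lambda>k. 1 * (c * unit j k)) = el i j c"
    unfolding el_def by (rule tv_cong) simp
  ultimately show "el i j c \<in> generate (SL_int n) (trans 1)"
    by (simp add: generate.incl)
qed

lemma el_in_cong_sub:
  assumes "i < n" "j < n" "i \<noteq> j"
  shows "el i j (q * c) \<in> cong_sub q"
proof -
  have "tv (unit i) (\<lambda>k. q * (c * unit j k)) \<in> trans q"
    using assms by (intro transI unimodular_unit) (simp_all add: dot_scale)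
  moreover have "tv (unit i) (\<lambda>k. q * (c * unit j k)) = el i j (q * c)"
    unfolding el_def by (rule tv_cong) simp
  ultimately show ?thesis
    unfolding cong_sub_def by (simp add: generate.incl)
qed

section \<open>Moving unimodular vectors within their class modulo q\<close>

lemma unimodular_multiple: "\<exists>d y'. unimodular y' \<and> (\<forall>k<n. y k = d * y' k)"
proof -
  define d where "d = Gcd (y ` {..<n})"
  obtain r where r: "(\<Sum>k<n. r k * y k) = d"
    using bezout_Gcd_int[of "{..<n}" y] unfolding d_def by auto
  have dvd: "d dvd y k" if "k < n" for k
    unfolding d_def using that by (intro Gcd_dvd) auto
  show ?thesis
  proof (cases "d = 0")
    case True
    then have "\<forall>k<n. y k = 0 * unit 0 k" using dvd by auto
    then show ?thesis using unimodular_unit[of 0] n3 by (intro exI[of _ 0] exI[of _ "unit 0"]) auto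
  next
    case False
    have eq: "y k = d * (y k div d)" if "k < n" for k
      using dvd[OF that] by simp
    have "d * dot r (\<lambda>k. y k div d) = (\<Sum>k<n. r k * (d * (y k div d)))"
      by (simp add: dot_def sum_distrib_left mult.left_commute)
    also have "\<dots> = (\<Sum>k<n. r k * y k)"
      using eq by (intro sum.cong refl arg_cong2[of _ _ _ _ "(*)"]) auto
    also have "\<dots> = d * 1"
      using r by simp
    finally have "dot r (\<lambda>k. y k div d) = 1"
      using False unfolding mult_cancel_left by blast
    then have "unimodular (\<lambda>k. y k div d)"
      unfolding unimodular_def by blast
    then show ?thesis using eq by blast
  qed
qed

text \<open>Removes unimodularity from the direction: the gcd of \<open>y\<close> is shifted into
  the covector.\<close>

lemma tv_in_cong_sub:
  assumes "dot w y = 0"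
  shows "tv y (\<lambda>k. q * w k) \<in> cong_sub q"
proof -
  obtain d y' where y: "unimodular y'" "\<And>k. k < n \<Longrightarrow> y k = d * y' k"
    using unimodular_multiple by blast
  have "d * dot w y' = dot w (\<lambda>k. d * y' k)"
    by (simp add: dot_scale)
  also have "\<dots> = dot w y"
    using y by (intro dot_cong) auto
  finally have "dot (\<lambda>k. d * w k) y' = 0"
    using assms by (simp add: dot_scale)
  then have "tv y' (\<lambda>k. q * (d * w k)) \<in> trans q"
    using y by (intro transI)
  moreover have "tv y' (\<lambda>k. q * (d * w k)) = tv y (\<lambda>k. q * w k)"
    by (rule tv_cong) (simp add: y)
  ultimately show ?thesis
    unfolding cong_sub_def by (simp add: generate.incl)
qed

text \<open>For \<open>v = unit 0 + q * y\<close>, the transvection along \<open>y\<close> by a covector \<open>w\<close> with \<open>w 0 = 1\<close> and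
  \<open>dot w y = 0\<close> moves \<open>v\<close> to \<open>unit 0\<close>. Such a \<open>w\<close> exists once the entries of \<open>y\<close> other than \<open>y 0\<close> have
  gcd 1, which elementary matrices of level \<open>q\<close> achieve.\<close>

definition reaches_unit :: "int \<Rightarrow> (nat \<Rightarrow> int) \<Rightarrow> bool" where
  "reaches_unit q v \<longleftrightarrow> (\<exists>x\<in>cong_sub q. \<forall>k<n. act x v k = unit 0 k)"

lemma cong_sub_mem_carrier: "x \<in> cong_sub q \<Longrightarrow> x \<in> carrier (SL_int n)"
  using cong_sub_normal by (meson normal_imp_subgroup subgroup.mem_carrier)

lemma cong_sub_mult: "x \<in> cong_sub q \<Longrightarrow> y \<in> cong_sub q \<Longrightarrow> x * y \<in> cong_sub q"
  using subgroup.m_closed[OF normal_imp_subgroup[OF cong_sub_normal]] by simp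

lemma reaches_unit_act:
  assumes "reaches_unit q v'" "x \<in> cong_sub q" "\<And>k. k < n \<Longrightarrow> act x v k = v' k"
  shows "reaches_unit q v"
proof -
  obtain y where y: "y \<in> cong_sub q" "\<And>k. k < n \<Longrightarrow> act y v' k = unit 0 k"
    using assms(1) by (auto simp: reaches_unit_def)
  have "act (y * x) v k = unit 0 k" if "k < n" for k
    using act_mult[OF _ _ that, of y x v] y assms(2,3) that act_cong[of "act x v" v' y k]
      cong_sub_mem_carrier SL_carrier_mat by simp
  then show ?thesis
    unfolding reaches_unit_def using cong_sub_mult[OF y(1) assms(2)] by blast
qed

lemma reaches_unit_if_orthogonal:
  assumes v: "\<And>k. k < n \<Longrightarrow> v k = unit 0 k + q * y k" and w: "w 0 = 1" "dot w y = 0"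
  shows "reaches_unit q v"
proof -
  have "dot w v = dot w (\<lambda>k. unit 0 k + q * y k)"
    using v by (intro dot_cong refl)
  also have "\<dots> = 1"
    using w n3 by (simp add: dot_add dot_scale)
  finally have wv: "dot w v = 1" .
  \<comment> \<open>Because \<open>dot w v = 1\<close>, the matrix I - q y w^T subtracts exactly q y
    from \<open>v\<close>.\<close>
  have "dot (\<lambda>k. -1 * w k) y = 0"
    unfolding dot_scale using w(2) by simp
  then have "tv y (\<lambda>k. q * (-1 * w k)) \<in> cong_sub q"
    by (rule tv_in_cong_sub)
  moreover have "act (tv y (\<lambda>k. q * (-1 * w k))) v k = unit 0 k" if "k < n" for k
    using v[OF that] that wv unfolding act_tv[OF that] dot_scale by simp
  ultimately show ?thesis
    unfolding reaches_unit_def by blast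
qed

lemma reaches_unit_if_coprime_tail:
  assumes v: "\<And>k. k < n \<Longrightarrow> v k = unit 0 k + q * y k" and y: "Gcd (y ` {1..<n}) = 1"
  shows "reaches_unit q v"
proof -
  obtain r where r: "(\<Sum>k\<in>{1..<n}. r k * y k) = 1"
    using bezout_Gcd_int[of "{1..<n}" y] y by auto
  \<comment> \<open>The tail of \<open>w\<close> pairs with the tail of \<open>y\<close> to
    \<open>- y 0\<close>, cancelling the contribution of entry 0.\<close>
  define w where "w k = (if k = 0 then 1 else - y 0 * r k)" for k
  have "{..<n} = insert 0 {1..<n}"
    using n3 by auto
  then have "dot w y = y 0 + (\<Sum>k\<in>{1..<n}. - y 0 * r k * y k)"
    unfolding dot_def by (auto simp: w_def intro!: sum.cong)
  also have "\<dots> = y 0 + - y 0 * (\<Sum>k\<in>{1..<n}. r k * y k)"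
    by (simp add: sum_distrib_left mult.assoc sum_negf)
  finally have "dot w y = 0"
    using r by simp
  then show ?thesis
    using v by (intro reaches_unit_if_orthogonal[of v q y w]) (auto simp: w_def)
qed

lemma prime_not_dvd_unimodular:
  assumes "unimodular v" "prime (p::int)" "\<And>k. k < n \<Longrightarrow> p dvd v k"
  shows False
proof -
  obtain r where "dot r v = 1" using assms(1) by (auto simp: unimodular_def)
  moreover have "p dvd dot r v"
    unfolding dot_def using assms(3) by (intro dvd_sum dvd_mult) auto
  ultimately show False using assms(2) by auto
qed

lemma unimodular_act: "x \<in> cong_sub q \<Longrightarrow> unimodular v \<Longrightarrow> unimodular (act x v)"
  using conj_tv_SL(3) cong_sub_mem_carrier by blast

text \<open>Adding \<open>q * t * v 0\<close> to entry 1 of \<open>v\<close> changes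
  \<open>y 1\<close> by \<open>t * v 0\<close>. Some \<open>t\<close> makes it coprime to the gcd
  \<open>c\<close> of the later entries, since a prime dividing \<open>y 1\<close>,
  \<open>v 0\<close> and \<open>c\<close> would divide all of \<open>v\<close>;
  \<open>y 2 \<noteq> 0\<close> ensures \<open>c \<noteq> 0\<close>.\<close>

lemma reaches_unit_if_tail_nonzero:
  assumes v: "\<And>k. k < n \<Longrightarrow> v k = unit 0 k + q * y k" "unimodular v"
    and y: "y 2 \<noteq> 0"
  shows "reaches_unit q v"
proof -
  define c where "c = Gcd (y ` {2..<n})"
  have "y 2 \<in> y ` {2..<n}" using n3 by auto
  then have "c \<noteq> 0" using y by (auto simp: c_def)
  have c_dvd: "c dvd y k" if "k \<in> {2..<n}" for k
    using that by (auto simp: c_def)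
  have "False" if p: "prime p" "p dvd y 1" "p dvd v 0" "p dvd c" for p
  proof (rule prime_not_dvd_unimodular[OF v(2) p(1)])
    fix k assume k: "k < n"
    consider "k = 0" | "k = 1" | "k \<in> {2..<n}" using k by fastforce
    then show "p dvd v k"
    proof cases
      case 2
      then show ?thesis using v(1)[OF k] p by simp
    next
      case 3
      then show ?thesis using v(1)[OF k] c_dvd[of k] p by (auto intro: dvd_trans)
    qed (use p in simp)
  qed
  then obtain t where t: "coprime (y 1 + t * v 0) c"
    using exists_coprime_add_mult[OF \<open>c \<noteq> 0\<close>, of "y 1" "v 0"] by blast
  define y' where "y' = y(1 := y 1 + t * v 0)"
  define v' where "v' k = unit 0 k + q * y' k" for k
  have "{1..<n} = insert 1 {2..<n}" using n3 by auto
  moreover have "y' ` {2..<n} = y ` {2..<n}" by (auto simp: y'_def)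
  ultimately have "y' ` {1..<n} = insert (y 1 + t * v 0) (y ` {2..<n})"
    by (simp only: image_insert) (simp add: y'_def)
  then have "Gcd (y' ` {1..<n}) = gcd (y 1 + t * v 0) c"
    by (simp only: Gcd_insert c_def)
  then have "Gcd (y' ` {1..<n}) = 1"
    using t by simp
  then have "reaches_unit q v'"
    by (intro reaches_unit_if_coprime_tail[of v' q y']) (auto simp: v'_def)
  moreover have "act (el 1 0 (q * t)) v k = v' k" if "k < n" for k
    using that n3 v(1)[OF that] act_el[of 1 0 k "q * t" v] by (simp add: v'_def y'_def algebra_simps)
  ultimately show ?thesis
    using reaches_unit_act el_in_cong_sub[of 1 0 q t] n3 by simp
qed

text \<open>If \<open>y 2\<close> vanishes, one elementary matrix of level \<open>q\<close> replaces
  it by \<open>v 0\<close>, which is nonzero as it is 1 modulo \<open>q \<ge> 2\<close>.\<close>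

lemma reaches_unit_if_cong:
  assumes q: "q \<ge> 2" and v: "\<And>k. k < n \<Longrightarrow> q dvd v k - unit 0 k" "unimodular v"
  shows "reaches_unit q v"
proof -
  define y where "y k = (v k - unit 0 k) div q" for k
  have vy: "v k = unit 0 k + q * y k" if "k < n" for k
    using v(1)[OF that] by (simp add: y_def)
  show ?thesis
  proof (cases "y 2 = 0")
    case False
    then show ?thesis using vy v(2) by (intro reaches_unit_if_tail_nonzero[of v q y])
  next
    case True
    have "v 0 \<noteq> 0"
    proof
      assume "v 0 = 0"
      then have "q dvd 1" using v(1)[of 0] n3 by simp
      then show False using q by simp
    qed
    define v' where "v' = act (el 2 0 (q * 1)) v"
    have e: "el 2 0 (q * 1) \<in> cong_sub q"
      using n3 by (intro el_in_cong_sub) auto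
    have "v' k = unit 0 k + q * (y(2 := y 2 + v 0)) k" if "k < n" for k
      using that n3 vy[OF that] act_el[of 2 0 k "q * 1" v] by (simp add: v'_def algebra_simps)
    then have "reaches_unit q v'"
      using True \<open>v 0 \<noteq> 0\<close> unimodular_act[OF e v(2)]
      by (intro reaches_unit_if_tail_nonzero[of v' q "y(2 := y 2 + v 0)"]) (auto simp: v'_def)
    then show ?thesis
      using e by (rule reaches_unit_act) (simp add: v'_def)
  qed
qed

text \<open>Transitivity of the whole group carries \<open>v'\<close> to \<open>unit 0\<close>, and
  normality carries the solution there back.\<close>

lemma cong_sub_moves_congruent:
  assumes q: "q \<ge> 2" and v: "unimodular v" "unimodular v'" "\<And>k. k < n \<Longrightarrow> q dvd v k - v' k"
  shows "\<exists>x\<in>cong_sub q. \<forall>k<n. act x v k = v' k"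
proof -
  obtain g where g: "g \<in> carrier (SL_int n)" "\<And>k. k < n \<Longrightarrow> act g v' k = unit 0 k"
    using transitive_on_unimodular[OF _ v(2)] n3 by auto
  define h where "h = inv\<^bsub>SL_int n\<^esub> g"
  have h: "h \<in> carrier (SL_int n)" "h * g = 1\<^sub>m n"
    using inv_closed[OF g(1)] l_inv[OF g(1)] by (auto simp: h_def)
  have "q dvd act g v k - unit 0 k" if "k < n" for k
  proof -
    have "act g v k - unit 0 k = (\<Sum>l<n. g $$ (k,l) * (v l - v' l))"
      unfolding g(2)[OF that, symmetric] act_def by (simp add: sum_subtractf right_diff_distrib)
    also have "q dvd \<dots>"
      using v(3) by (intro dvd_sum dvd_mult) auto
    finally show ?thesis .
  qed
  then have "reaches_unit q (act g v)"
    using conj_tv_SL(3)[OF g(1) v(1)] q by (intro reaches_unit_if_cong)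
  then obtain x where x: "x \<in> cong_sub q" "\<And>k. k < n \<Longrightarrow> act x (act g v) k = unit 0 k"
    by (auto simp: reaches_unit_def)
  have "h * x * g \<in> cong_sub q"
    using normal.inv_op_closed1[OF cong_sub_normal g(1) x(1)] by (simp add: h_def)
  moreover have "act (h * x * g) v k = v' k" if k: "k < n" for k
  proof -
    have c: "g \<in> carrier_mat n n" "h \<in> carrier_mat n n" "x \<in> carrier_mat n n" "h * x \<in> carrier_mat n n"
      using g(1) h(1) x(1) cong_sub_mem_carrier SL_carrier_mat by (auto intro!: mult_carrier_mat[of _ n n])
    have "act (h * x * g) v k = act h (act x (act g v)) k"
      using act_mult[OF c(4,1) k] act_mult[OF c(2,3) k] by simp
    also have "\<dots> = act h (act g v') k"
      using x(2) g(2) by (intro act_cong) simp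
    also have "\<dots> = v' k"
      using act_mult[OF c(2,1) k, of v'] h(2) k by simp
    finally show ?thesis .
  qed
  ultimately show ?thesis by blast
qed

text \<open>The covectors differ by \<open>q * z\<close> with \<open>z\<close> again orthogonal to
  \<open>v\<close>, so the two transvections differ by a left factor in
  \<open>cong_sub q\<close>.\<close>

lemma rcos_tv_eq:
  assumes v: "unimodular v" and w: "dot w v = 0" "dot w' v = 0"
    and dvd: "\<And>k. k < n \<Longrightarrow> q dvd w k - w' k" and "q \<noteq> 0"
  shows "cong_sub q #>\<^bsub>SL_int n\<^esub> tv v w = cong_sub q #>\<^bsub>SL_int n\<^esub> tv v w'"
proof -
  define z where "z k = (w k - w' k) div q" for k
  have z: "w k = q * z k + w' k" if "k < n" for k
    using dvd[OF that] by (simp add: z_def)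
  have "dot w v = dot (\<lambda>k. q * z k + w' k) v"
    using z by (intro dot_cong refl)
  then have dz: "dot z v = 0"
    using w \<open>q \<noteq> 0\<close> by (simp add: dot_add dot_scale)
  have "tv v w = tv v (\<lambda>k. q * z k + w' k)"
    using z by (intro tv_cong) simp
  also have "\<dots> = tv v (\<lambda>k. q * z k) * tv v w'"
    using dz by (intro tv_mult_tv_row[symmetric]) (simp add: dot_scale)
  finally have "tv v w = tv v (\<lambda>k. q * z k) * tv v w'" .
  then show ?thesis
    using rcos_mult_left[OF normal_imp_subgroup[OF cong_sub_normal] tv_in_cong_sub[OF dz] tv_in_SL[OF v w(2)]]
    by simp
qed

section \<open>Counting the cosets of transvections\<close>

lemma finite_residues:
  assumes "q > 0"
  shows "finite ((\<lambda>v. restrict (\<lambda>k. v k mod q) {..<n}) ` (A :: (nat \<Rightarrow> int) set))"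
proof (rule finite_subset)
  \<comment> \<open>Restriction discards the arbitrary values from \<open>n\<close> on, which would
    otherwise give infinitely many residue functions.\<close>
  show "(\<lambda>v. restrict (\<lambda>k. v k mod q) {..<n}) ` A \<subseteq> {..<n} \<rightarrow>\<^sub>E {0..<q}"
    using assms by (intro image_subsetI) (simp only: restrict_PiE_iff, simp)
qed (auto intro!: finite_PiE)

lemma residues_eqD:
  assumes "restrict (\<lambda>k. v k mod q) {..<n} = restrict (\<lambda>k. w k mod (q::int)) {..<n}" "k < n"
  shows "q dvd v k - w k"
  using fun_cong[OF assms(1), of k] assms(2) by (simp add: mod_eq_dvd_iff)

lemma finite_trans_mod_cong_sub:
  assumes q: "q \<ge> 2"
  shows "finite ((\<lambda>t. cong_sub q #>\<^bsub>SL_int n\<^esub> t) ` trans 1)"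
proof -
  define red where "red v = restrict (\<lambda>k. v k mod q) {..<n}" for v :: "nat \<Rightarrow> int"
  have fin_red: "finite (red ` A)" for A
    unfolding red_def using finite_residues[of q A] q by simp
  define V where "V = {v. unimodular v}"
  \<comment> \<open>Representatives are chosen among the unimodular vectors, so that each of them is
    again an admissible direction.\<close>
  obtain V0 where V0: "V0 \<subseteq> V" "finite V0" "red ` V = red ` V0"
    using fin_red[of V] by (meson finite_subset_image subset_refl)
  define F where "F v w = cong_sub q #>\<^bsub>SL_int n\<^esub> tv v w" for v w
  have "(\<lambda>t. cong_sub q #>\<^bsub>SL_int n\<^esub> t) ` trans 1 \<subseteq> (\<Union>v\<in>V0. F v ` {w. dot w v = 0})"
  proof
    fix C assume "C \<in> (\<lambda>t. cong_sub q #>\<^bsub>SL_int n\<^esub> t) ` trans 1"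
    then obtain v w where vw: "unimodular v" "dot w v = 0" "C = F v w"
      by (auto simp: trans_def F_def)
    then have "red v \<in> red ` V"
      by (simp add: V_def)
    then obtain v0 where v0: "v0 \<in> V0" "red v = red v0"
      unfolding V0(3) by (rule imageE)
    then have uni: "unimodular v0" using V0(1) by (auto simp: V_def)
    have "q dvd v k - v0 k" if "k < n" for k
      using residues_eqD[OF _ that] v0(2) by (simp add: red_def)
    then obtain x where x: "x \<in> cong_sub q" "\<And>k. k < n \<Longrightarrow> act x v k = v0 k"
      using cong_sub_moves_congruent[OF q vw(1) uni] by blast
    \<comment> \<open>Conjugation by \<open>x\<close> carries the covector along; the coset is
      unchanged because \<open>x\<close> lies in \<open>cong_sub q\<close>.\<close>
    define w0 where "w0 = coact (inv\<^bsub>SL_int n\<^esub> x) w"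
    note xc = cong_sub_mem_carrier[OF x(1)]
    have "x * tv v w * inv\<^bsub>SL_int n\<^esub> x = tv v0 w0"
      unfolding conj_tv_SL(1)[OF xc] w0_def using x(2) by (intro tv_cong) simp
    then have "C = F v0 w0"
      using rcos_conj[OF cong_sub_normal x(1) tv_in_SL[OF vw(1,2)]] vw(3) by (simp add: F_def)
    moreover have "dot w0 v0 = 0"
    proof -
      have "dot w0 v0 = dot w0 (act x v)"
        using x(2) by (intro dot_cong) auto
      then show ?thesis
        using conj_tv_SL(2)[OF xc, of w v] vw(2) by (simp add: w0_def)
    qed
    ultimately show "C \<in> (\<Union>v\<in>V0. F v ` {w. dot w v = 0})"
      using v0(1) by blast
  qed
  moreover have "finite (\<Union>v\<in>V0. F v ` {w. dot w v = 0})"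
  proof (rule finite_UN_I[OF V0(2)])
    fix v assume v: "v \<in> V0"
    show "finite (F v ` {w. dot w v = 0})"
    proof (rule finite_image_if_factors[OF fin_red])
      fix a b assume "a \<in> {w. dot w v = 0}" "b \<in> {w. dot w v = 0}" "red a = red b"
      then show "F v a = F v b"
        unfolding F_def red_def using v V0(1) q residues_eqD[of a q b]
        by (intro rcos_tv_eq[of v a b q]) (auto simp: V_def)
    qed
  qed
  ultimately show ?thesis
    by (rule finite_subset)
qed

lemma tv_pow:
  assumes "dot w v = 0"
  shows "tv v w [^]\<^bsub>SL_int n\<^esub> (k::nat) = tv v (\<lambda>i. int k * w i)"
proof (induction k)
  case (Suc k)
  have "tv v (\<lambda>i. int k * w i) * tv v w = tv v (\<lambda>i. int k * w i + w i)"
    using assms by (intro tv_mult_tv_row) (simp add: dot_scale)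
  then show ?case
    using Suc by (simp add: algebra_simps)
qed (simp add: tv_zero)

lemma finite_lcosets_if_el:
  assumes H: "subgroup H (SL_int n)" and m: "m \<ge> 2"
    and el: "\<And>i j z. i < n \<Longrightarrow> j < n \<Longrightarrow> i \<noteq> j \<Longrightarrow> el i j (m * z) \<in> H"
  shows "finite (lcosets\<^bsub>SL_int n\<^esub> H)"
proof -
  \<comment> \<open>The level at which all transvections are known to lie in
    \<open>H\<close>.\<close>
  define q where "q = m\<^sup>2"
  have q: "q \<ge> 2" using m power_mono[of 2 m 2] by (simp add: q_def)
  interpret special_linear_subgroup n H
    by (intro special_linear_subgroup.intro H)
  have "trans q \<subseteq> H"
    using tv_in_subgroup_if_el_in_subgroup[OF n3 el] by (auto simp: trans_def q_def)
  then have sub: "cong_sub q \<subseteq> H"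
    unfolding cong_sub_def by (rule generate_subgroup_incl[OF _ H])
  have pow: "t [^]\<^bsub>SL_int n\<^esub> nat q \<in> cong_sub q" if t1: "t \<in> trans 1" for t
  proof -
    obtain v w where t: "t = tv v w" "unimodular v" "dot w v = 0"
      using t1 by (auto simp: trans_def)
    then show ?thesis
      using tv_pow[OF t(3), of "nat q"] q tv_in_cong_sub[OF t(3), of q] by simp
  qed
  show ?thesis
    by (rule finite_lcosets_if_generated_mod_normal[OF cong_sub_normal H sub trans_closed
        generate_trans_one trans_conj trans_inv pow _ finite_trans_mod_cong_sub]) (use q in auto)
qed

end

section \<open>Exponential distortion of elementary matrices\<close>

text \<open>The recursion \<open>(x, y) \<mapsto> (x + 2 y, 2 x + 5 y)\<close> is the conjugation action of \<open>a\<close> on the plane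
  of the elements \<open>M x y\<close>. Greedy expansion along its orbit of \<open>(0, 1)\<close> writes every \<open>y\<close> below
  the \<open>L\<close>-th second coordinate with digits below 7, so a Horner scheme gives words of length
  linear in \<open>L\<close>.\<close>

fun orbit :: "nat \<Rightarrow> nat \<times> nat" where
  "orbit 0 = (0, 1)"
| "orbit (Suc L) = (let (x, y) = orbit L in (x + 2 * y, 2 * x + 5 * y))"

text \<open>With x <= y the new coordinate 2x + 5y lies between 5y and 7y: the upper bound limits
  the digits, the lower one gives exponential growth.\<close>

lemma orbit_bounds:
  "fst (orbit L) \<le> snd (orbit L) \<and> 2 ^ L \<le> snd (orbit L) \<and> snd (orbit (Suc L)) \<le> 7 * snd (orbit L)"
  by (induction L) (auto simp: Let_def case_prod_unfold)

text \<open>The greedy expansion controls only the second coordinate of \<open>M x y\<close>. That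
  is enough, since the commutator with \<open>t\<close> is \<open>u [^] y\<close> whatever
  \<open>x\<close> is.\<close>

lemma (in group_with_generators) powers_exponentially_distorted:
  fixes M :: "nat \<Rightarrow> nat \<Rightarrow> 'a"
  assumes a: "a \<in> carrier G" and t: "t \<in> carrier G" and u: "u \<in> carrier G"
    and M: "\<And>x y. M x y \<in> carrier G"
    and add: "\<And>x y x' y'. M x y \<otimes> M x' y' = M (x + x') (y + y')"
    and conj: "\<And>x y. a \<otimes> M x y = M (x + 2 * y) (2 * x + 5 * y) \<otimes> a"
    and commutator: "\<And>x y. t \<otimes> M x y = u [^] y \<otimes> M x y \<otimes> t"
  shows "\<exists>c. \<forall>L y. y < 2 ^ L \<longrightarrow> len (u [^] (y::nat)) \<le> c * L"
proof -
  have conj_pow: "a [^] L \<otimes> M 0 q = M (q * fst (orbit L)) (q * snd (orbit L)) \<otimes> a [^] L" for L q :: nat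
  proof (induction L)
    case 0
    then show ?case using a M by simp
  next
    case (Suc L)
    let ?m = "M (q * fst (orbit L)) (q * snd (orbit L))"
    have pow: "a [^] Suc L = a \<otimes> a [^] L"
      by (rule nat_pow_Suc2[OF a])
    have "a [^] Suc L \<otimes> M 0 q = a \<otimes> (a [^] L \<otimes> M 0 q)"
      unfolding pow using a M by (simp add: m_assoc)
    also have "\<dots> = (a \<otimes> ?m) \<otimes> a [^] L"
      using a M by (simp add: Suc m_assoc)
    also have "a \<otimes> ?m = M (q * fst (orbit (Suc L))) (q * snd (orbit (Suc L))) \<otimes> a"
      by (simp add: conj Let_def case_prod_unfold algebra_simps)
    finally show ?case
      unfolding pow using a M by (simp add: m_assoc del: orbit.simps)
  qed
  define c where "c = 7 * len (M 0 1) + len a"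
  have pow_M: "M 0 q = M 0 1 [^] q \<otimes> M 0 0" for q :: nat
  proof (induction q)
    case (Suc q)
    have "M 0 (Suc q) = M 0 1 \<otimes> M 0 q" by (simp add: add)
    then show ?case using Suc M nat_pow_Suc2[of "M 0 1" q] by (simp add: m_assoc del: nat_pow_Suc)
  qed (use M in simp)
  have "M 0 0 \<otimes> M 0 0 = M 0 0" by (simp add: add)
  then have M0: "M 0 0 = \<one>"
    using M by simp
  have len_M: "len (M 0 q) \<le> q * len (M 0 1)" for q
    using len_pow[OF M, of 0 1 q] pow_M[of q] M0 M by simp
  \<comment> \<open>The factor \<open>a [^] L\<close> stays on the right so that each new digit only
    appends to the word; it is cancelled once at the end.\<close>
  have greedy: "\<exists>x. len (M x y \<otimes> a [^] L) \<le> c * L" if "y < snd (orbit L)" for y L :: nat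
    using that
  proof (induction L arbitrary: y)
    case 0
    then show ?case using M0 by (auto intro!: exI[of _ 0])
  next
    case (Suc L)
    define q r where "q = y div snd (orbit L)" and "r = y mod snd (orbit L)"
    have pos: "snd (orbit L) > 0"
      using orbit_bounds[of L] by (metis less_le_trans zero_less_numeral zero_less_power)
    have y: "y = q * snd (orbit L) + r" "r < snd (orbit L)"
      using pos by (simp_all add: q_def r_def)
    have "q * snd (orbit L) < 7 * snd (orbit L)"
      using Suc.prems orbit_bounds[of L] y(1) by linarith
    then have q: "q \<le> 7" by simp
    obtain x where x: "len (M x r \<otimes> a [^] L) \<le> c * L"
      using Suc.IH[OF y(2)] by blast
    \<comment> \<open>Horner step: moving \<open>a [^] L\<close> past the digit \<open>M 0 q\<close>
      turns it into \<open>q\<close> times the \<open>L\<close>-th orbit vector.\<close>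
    have "M (x + q * fst (orbit L)) y \<otimes> a [^] Suc L =
        M x r \<otimes> (M (q * fst (orbit L)) (q * snd (orbit L)) \<otimes> a [^] L) \<otimes> a"
      using a M by (simp add: y(1) add[symmetric] m_assoc add.commute[of "q * _" r])
    also have "\<dots> = (M x r \<otimes> a [^] L) \<otimes> (M 0 q \<otimes> a)"
      using a M by (simp add: conj_pow[symmetric] m_assoc)
    finally have "len (M (x + q * fst (orbit L)) y \<otimes> a [^] Suc L) \<le>
        len (M x r \<otimes> a [^] L) + (len (M 0 q) + len a)"
      using a M len_mult[of "M x r \<otimes> a [^] L" "M 0 q \<otimes> a"] len_mult[of "M 0 q" a] by simp
    also have "\<dots> \<le> c * L + (7 * len (M 0 1) + len a)"
      using x len_M[of q] mult_right_mono[OF q, of "len (M 0 1)"] by linarith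
    finally show ?case
      by (intro exI[of _ "x + q * fst (orbit L)"]) (simp add: c_def algebra_simps)
  qed
  define c' where "c' = 2 * (c + len a) + 2 * len t"
  have "len (u [^] y) \<le> c' * L" if y: "y < 2 ^ L" for L y :: nat
  proof (cases "L = 0")
    case False
    have "y < snd (orbit L)"
      using y orbit_bounds[of L] by linarith
    then obtain x where x: "len (M x y \<otimes> a [^] L) \<le> c * L"
      using greedy by blast
    have "M x y = (M x y \<otimes> a [^] L) \<otimes> inv (a [^] L)"
      using a M by (simp add: m_assoc)
    then have "len (M x y) \<le> len (M x y \<otimes> a [^] L) + len (inv (a [^] L))"
      using a M len_mult[of "M x y \<otimes> a [^] L" "inv (a [^] L)"] by simp
    then have lM: "len (M x y) \<le> c * L + L * len a"
      using x len_inv[of "a [^] L"] len_pow[OF a, of L] a by simp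
    \<comment> \<open>Now \<open>u [^] y\<close> is a commutator of \<open>t\<close> with the short
      element \<open>M x y\<close>.\<close>
    have "u [^] y \<otimes> (M x y \<otimes> t) = t \<otimes> M x y"
      using commutator[of x y] u M t by (simp add: m_assoc)
    then have "u [^] y = (t \<otimes> M x y) \<otimes> inv (M x y \<otimes> t)"
      using u M t inv_solve_right[of "u [^] y" "t \<otimes> M x y" "M x y \<otimes> t"] by simp
    then have "len (u [^] y) \<le> len (t \<otimes> M x y) + len (inv (M x y \<otimes> t))"
      using M t len_mult[of "t \<otimes> M x y" "inv (M x y \<otimes> t)"] by simp
    also have "\<dots> \<le> 2 * (len (M x y) + len t)"
      using len_mult[of t "M x y"] len_mult[of "M x y" t] len_inv[of "M x y \<otimes> t"] M t by simp
    also have "\<dots> \<le> 2 * (c * L + L * len a + L * len t)"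
    proof -
      have "len t \<le> L * len t" using False by simp
      then show ?thesis
        using lM by (intro mult_le_mono2 add_mono)
    qed
    finally show ?thesis by (simp add: c'_def algebra_simps)
  qed (use y in simp)
  then show ?thesis by blast
qed

section \<open>Elementary matrices as distorted elements, and the conclusion\<close>

context special_linear_ge3
begin

lemma el_inverse:
  assumes "i < n" "j < n" "i \<noteq> j"
  shows "inv\<^bsub>SL_int n\<^esub> (el i j c) = el i j (- c)"
proof -
  have eq: "el i j c = tv (unit i) (\<lambda>k. c * unit j k)" for c
    unfolding el_def by (rule tv_cong) simp
  then show ?thesis
    using inv_tv[OF unimodular_unit[OF assms(1)], of "\<lambda>k. c * unit j k"] assms
    by (simp add: dot_scale)
qed

lemma el_pow:
  assumes "i < n" "j < n" "i \<noteq> j"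
  shows "el i j c [^]\<^bsub>SL_int n\<^esub> (k::nat) = el i j (c * int k)"
proof -
  have eq: "el i j c = tv (unit i) (\<lambda>k. c * unit j k)" for c
    unfolding el_def by (rule tv_cong) simp
  show ?thesis
    unfolding eq using assms by (subst tv_pow) (simp_all add: dot_scale mult_ac)
qed

text \<open>Column \<open>j\<close> with entries in rows \<open>i\<close> and \<open>l\<close> is a
  plane of commuting transvections, on which the block in coordinates \<open>i\<close>,
  \<open>l\<close> acts linearly.\<close>

lemma el_exponentially_distorted:
  assumes S: "finite S" "symmetric_generating_set (SL_int n) S" and ij: "i < n" "j < n" "i \<noteq> j"
  shows "\<exists>c. \<forall>L y. y < 2 ^ L \<longrightarrow>
    word_length (SL_int n) S (el i j 1 [^]\<^bsub>SL_int n\<^esub> (y::nat)) \<le> c * L"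
proof -
  interpret gg: group_with_generators "SL_int n" S
    by (intro group_with_generators.intro group_with_generators_axioms.intro is_group S)
  obtain l where l: "l < n" "l \<noteq> i" "l \<noteq> j"
    using exists_third_index[OF n3] by blast
  define M where "M x y = tv (\<lambda>k. int x * unit i k + int y * unit l k) (unit j)" for x y :: nat
  \<comment> \<open>On the coordinates (x, y) of the plane this is the hyperbolic matrix with rows
    (1, 2) and (2, 5); its positive entries keep the recursion in the naturals.\<close>
  define a where "a = el l i 2 * el i l 2"
  have dM: "dot (unit j) (\<lambda>k. int x * unit i k + int y * unit l k) = 0" for x y :: nat
    using ij l by simp
  have el_c: "el l i c \<in> carrier (SL_int n)" "el i l c \<in> carrier (SL_int n)" for c
    using el_in_SL ij l by auto
  have aS: "a \<in> carrier (SL_int n)"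
    unfolding a_def using m_closed[OF el_c(1) el_c(2)] by simp
  have add: "M x y * M x' y' = M (x + x') (y + y')" for x y x' y'
    unfolding M_def using dM by (subst tv_mult_tv_col) (auto simp: algebra_simps intro!: tv_cong)
  have M_el: "M x y = el i j (int x) * el l j (int y)" for x y
    unfolding M_def el_def using ij l by (subst tv_mult_tv_col) (auto simp: dot_scale)
  have MS: "M x y \<in> carrier (SL_int n)" for x y
    unfolding M_el using m_closed[OF el_in_SL[of i j] el_in_SL[of l j]] ij l by simp
  \<comment> \<open>As \<open>p \<noteq> j\<close>, the covector \<open>unit j\<close> is fixed and
    only the direction \<open>v\<close> undergoes the row operation.\<close>
  have step: "el p s c * tv v (unit j) = tv (\<lambda>k. v k + c * v s * unit p k) (unit j) * el p s c"
    if "p < n" "s < n" "p \<noteq> s" "p \<noteq> j" for p s c v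
  proof (rule mat_eqI)
    show "el p s c * tv v (unit j) \<in> carrier_mat n n"
      "tv (\<lambda>k. v k + c * v s * unit p k) (unit j) * el p s c \<in> carrier_mat n n"
      by (auto intro!: mult_carrier_mat[of _ n n] simp: el_def)
    have elc: "el p s c \<in> carrier_mat n n"
      by (simp add: el_def)
    fix k m assume km: "k < n" "m < n"
    have "coact (el p s c) (unit j) m = unit j m"
      unfolding el_def coact_tv[OF km(2)] using that ij by (simp add: dot_scale)
    then show "(el p s c * tv v (unit j)) $$ (k,m) = (tv (\<lambda>k. v k + c * v s * unit p k) (unit j) * el p s c) $$ (k,m)"
      unfolding mult_tv_entry[OF elc km] tv_mult_entry[OF elc km] act_el[OF that(1,2) km(1)]
      by (simp add: unit_def)
  qed
  have conj: "a * M x y = M (x + 2 * y) (2 * x + 5 * y) * a" for x y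
  proof -
    have c: "el l i 2 \<in> carrier_mat n n" "el i l 2 \<in> carrier_mat n n" "M x y \<in> carrier_mat n n"
       "M (x + 2 * y) y \<in> carrier_mat n n" "M (x + 2 * y) (2 * x + 5 * y) \<in> carrier_mat n n"
      using el_c MS SL_carrier_mat by auto
    have "el i l 2 * M x y = M (x + 2 * y) y * el i l 2"
      unfolding M_def using ij l step[of i l 2 "\<lambda>k. int x * unit i k + int y * unit l k"]
      by (simp add: algebra_simps)
    moreover have "el l i 2 * M (x + 2 * y) y = M (x + 2 * y) (2 * x + 5 * y) * el l i 2"
      unfolding M_def using ij l step[of l i 2 "\<lambda>k. int (x + 2 * y) * unit i k + int y * unit l k"]
      by (simp add: algebra_simps)
    moreover have "a * M x y = el l i 2 * (el i l 2 * M x y)"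
      unfolding a_def using c by (intro assoc_mult_mat[of _ n n _ n _ n])
    moreover have "el l i 2 * (M (x + 2 * y) y * el i l 2) = (el l i 2 * M (x + 2 * y) y) * el i l 2"
      using c by (intro assoc_mult_mat[of _ n n _ n _ n, symmetric])
    moreover have "(M (x + 2 * y) (2 * x + 5 * y) * el l i 2) * el i l 2 = M (x + 2 * y) (2 * x + 5 * y) * a"
      unfolding a_def using c by (intro assoc_mult_mat[of _ n n _ n _ n])
    ultimately show ?thesis by (simp only:)
  qed
  have comm: "el i l 1 * M x y = el i j 1 [^]\<^bsub>SL_int n\<^esub> y * M x y * el i l 1" for x y
  proof -
    \<comment> \<open>The shear adds y to the first coordinate, so the commutator is
      \<open>M y 0\<close>, a power of the elementary matrix.\<close>
    have "el i l 1 * M x y = M (x + y) y * el i l 1"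
      unfolding M_def using ij l step[of i l 1 "\<lambda>k. int x * unit i k + int y * unit l k"]
      by (simp add: algebra_simps)
    also have "M (x + y) y = M y 0 * M x y"
      by (simp add: add add.commute)
    also have "M y 0 = el i j 1 [^]\<^bsub>SL_int n\<^esub> y"
      using el_pow[OF ij, of 1 y] by (simp add: M_def el_def)
    finally show ?thesis .
  qed
  show ?thesis
    using gg.powers_exponentially_distorted[of a "el i l 1" "el i j 1" M] aS el_c el_in_SL[OF ij] MS add conj comm
    by simp
qed

lemma finite_index_if_SLC_subexp:
  assumes S: "finite S" "symmetric_generating_set (SL_int n) S" and H: "subgroup H (SL_int n)"
    and slc: "SLC_subexp (SL_int n) H (word_length (SL_int n) S)"
  shows "finite_index (SL_int n) H"
proof -
  interpret gg: group_with_generators "SL_int n" S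
    by (intro group_with_generators.intro group_with_generators_axioms.intro is_group S)
  interpret K: special_linear_subgroup n H
    by (intro special_linear_subgroup.intro H)
  have "\<exists>m>0. el i j (int m) \<in> H" if ij: "i < n" "j < n" "i \<noteq> j" for i j
  proof -
    obtain c where c: "\<And>L y. y < 2 ^ L \<Longrightarrow>
        word_length (SL_int n) S (el i j 1 [^]\<^bsub>SL_int n\<^esub> (y::nat)) \<le> c * L"
      using el_exponentially_distorted[OF S ij] by blast
    obtain m :: nat where "m > 0" "el i j 1 [^]\<^bsub>SL_int n\<^esub> m \<in> H"
      using gg.SLC_subexp_imp_power_mem[OF H slc el_in_SL[OF ij] c] by blast
    then show ?thesis
      using el_pow[OF ij, of 1 m] by auto
  qed
  then obtain f where f: "\<And>i j. i < n \<Longrightarrow> j < n \<Longrightarrow> i \<noteq> j \<Longrightarrow> f i j > (0::nat) \<and> el i j (int (f i j)) \<in> H"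
    by metis
  define F where "F i j = (if i = j then 1 else f i j)" for i j
  \<comment> \<open>A common multiple of all exponents; the factor 2 secures
    \<open>m \<ge> 2\<close>, and the diagonal value 1 of \<open>F\<close> keeps the product
    positive.\<close>
  define m where "m = 2 * (\<Prod>i<n. \<Prod>j<n. F i j)"
  have "F i j > 0" if "i < n" "j < n" for i j
    using f that by (auto simp: F_def)
  then have "(\<Prod>i<n. \<Prod>j<n. F i j) > 0"
    by (intro prod_pos) auto
  then have "m \<ge> 2" unfolding m_def by linarith
  then have m2: "int m \<ge> 2" by simp
  have el: "el i j (int m * z) \<in> H" if ij: "i < n" "j < n" "i \<noteq> j" for i j z
  proof -
    have "F i j dvd (\<Prod>j<n. F i j)" "(\<Prod>j<n. F i j) dvd (\<Prod>i<n. \<Prod>j<n. F i j)"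
      using ij by (auto intro: dvd_prodI)
    then have "f i j dvd m"
      using ij by (auto simp: m_def F_def intro: dvd_trans)
    then obtain s where s: "m = f i j * s" by (auto simp: dvd_def)
    have pow: "el i j (int (f i j) * int k) \<in> H" for k
    proof -
      have "el i j (int (f i j)) [^]\<^bsub>SL_int n\<^esub> k \<in> H"
        by (induction k) (use f[OF ij] K.K_one K.K_mult in auto)
      then show ?thesis
        using el_pow[OF ij] by simp
    qed
    show ?thesis
    proof (cases "z \<ge> 0")
      case True
      then show ?thesis using pow[of "s * nat z"] by (simp add: s mult.assoc)
    next
      case False
      then have "el i j (- (int m * z)) \<in> H"
        using pow[of "s * nat (- z)"] by (simp add: s mult.assoc)
      then show ?thesis
        using K.K_inv[of "el i j (- (int m * z))"] el_inverse[OF ij, of "- (int m * z)"] by simp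
    qed
  qed
  then show ?thesis
    unfolding finite_index_def by (intro finite_lcosets_if_el[OF H m2])
qed

end

theorem theorem1p4:
  fixes n :: nat and S H :: "int mat set"
  assumes "n \<ge> 3"
    and "finite S" and "symmetric_generating_set (SL_int n) S"
    and "subgroup H (SL_int n)"
  shows "(SLC_subexp (SL_int n) H (word_length (SL_int n) S) \<longleftrightarrow>
            pair_rapid_decay (SL_int n) H (word_length (SL_int n) S)) \<and>
         (pair_rapid_decay (SL_int n) H (word_length (SL_int n) S) \<longleftrightarrow>
            finite_index (SL_int n) H)"
proof -
  interpret special_linear_ge3 n
    by unfold_locales (rule assms(1))
  interpret gg: group_with_generators "SL_int n" S
    by (intro group_with_generators.intro group_with_generators_axioms.intro is_group assms)
  \<comment> \<open>The implications form a cycle: subexponential weight, finite index, rapid decay,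
    subexponential weight.\<close>
  show ?thesis
    using finite_index_if_SLC_subexp[OF assms(2-4)] gg.SLC_subexp_if_pair_rapid_decay[of H]
      gg.pair_rapid_decay_if_finite_index[OF assms(4)] by blast
qed

end
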